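(* Let $f=(f_n(q))_{n\in\mathbb{N}}$, $f_n(q)\in\mathbb{Q}(q)$, be a $q$-holonomic sequence, let $P_f$ be its homogeneous annihilator, let $s(f)$ be the set of slopes of $f$, and let $s(N_{P_f,0})$ be the set of slopes of the edges of the polygon $N_{P_f,0}$. Then $$s(f)\subset -\,s(N_{P_f,0}).$$
   Context: **$q$-holonomic sequences.** A sequence $f=(f_n(q))_{n\in\mathbb{N}}$ of rational functions $f_n(q)\in\mathbb{Q}(q)$ is $q$-holonomic if there are $d\ge 0$ and polynomials $a_0(M,q),\dots,a_d(M,q)\in\mathbb{Z}[M,q]$ with $a_d\neq 0$ such that $\sum_{i=0}^d a_i(q^n,q)f_{n+i}(q)=0$ for all $n$. **Operators.** The operators $M,L$ act on sequences by $(Mf)_n(q)=q^nf_n(q)$ and $(Lf)_n(q)=f_{n+1}(q)$; they satisfy $LM=qML$. The $q$-Weyl algebra is $W=\mathbb{Z}[q^{\pm1}]\langle M,L\rangle/(LM-qML)$, and the localized $q$-Weyl algebra is $W_{\mathrm{loc}}=\mathbb{Q}(M,q)\langle L\rangle/(L\,a(M,q)-a(Mq,q)L : a\in\mathbb{Q}(M,q))$, in which every left ideal is principal. A coefficient $a(M,q)\in\mathbb{Q}(M,q)$ acts on a sequence by multiplication of the $n$-th term by $a(q^n,q)$, which is defined for all sufficiently large $n$; identities $Pf=0$ with $P\in W_{\mathrm{loc}}$ are understood for all sufficiently large $n$. **Homogeneous annihilator.** For $f$ $q$-holonomic, the left ideal $M_f=\{P\in W_{\mathrm{loc}} : Pf=0\}$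 is nonzero and principal. Let $P'$ be its monic generator (monic in $L$, i.e. monic of minimal $L$-degree). Multiply $P'$ on the left by an element of $\mathbb{Q}(M,q)$ to obtain $P_f=\sum_{i=0}^d a_i(M,q)L^i$ with $a_i(M,q)\in\mathbb{Z}[M,q]$ whose greatest common divisor in $\mathbb{Z}[M,q]$ is $1$. This $P_f\in W$ (unique up to sign) is the homogeneous annihilator of $f$. **The polygon $N_{P,0}$.** Write $P\in W$ uniquely as $P=\sum_{(i,j,k)\in\mathcal{A}}a_{i,j,k}\,q^kM^jL^i$ with $\mathcal{A}$ finite and all $a_{i,j,k}\in\mathbb{Z}\setminus\{0\}$ (powers of $M$ to the left of powers of $L$). Then $N_{P,0}\subset\mathbb{R}^2$ is the convex hull of the points $(i,j)$ for $(i,j,k)\in\mathcal{A}$, i.e. the Newton polygon in the coordinates ($L$-exponent, $M$-exponent). For a convex polygon $N$ in the plane (possibly degenerate to a segment, which is then its own edge), $s(N)\subset\mathbb{Q}\cup\{\infty\}$ is the set of slopes of its edges, where the edge joining $(i,j)$ and $(i',j')$ has slope $(j-j')/(i-i')$ (equal to $\infty$ if $i=i'$). $-s(N)$ denotes the set of negatives of these slopes. **Slopes of $f$.** $\deg_q$ of a nonzero rational function in $q$ is the degree of the numerator minus the degree of the denominator. A quadratic quasi-polynomial is a function of the form $p(n)=\gamma_2(n)\binom n2+\gamma_1(n)n+\gamma_0(n)$, where $\gamma_0,\gamma_1,\gamma_2$ are rational-valued periodic functions of $n\in\mathbb{N}$; its set of slopes $s(p)$ is the finite set of values of $\gamma_2$.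 It is a known theorem that for a $q$-holonomic sequence $f$ (with $f_n\ne0$ for large $n$, so that the degree is defined) $\deg_q f_n(q)$ agrees for all large $n$ with a quadratic quasi-polynomial $p$. The set of slopes of $f$ is $s(f):=s(p)$. *)

theory Defs
  imports
    "HOL-Analysis.Polytope"
    "HOL-Library.Extended_Real"
    "HOL-Computational_Algebra.Polynomial_Factorial"
begin

text \<open>
  The field \<open>\<rat>(q)\<close> is the fraction field of \<open>\<int>[q]\<close>. In \<open>\<int>[M,q] = \<int>[q][M]\<close> the outer
  polynomial variable is \<open>M\<close> and the inner one is \<open>q\<close>; \<open>\<rat>(M,q)\<close> is its fraction field.
\<close>

type_synonym Zq = "int poly"
type_synonym Qq = "Zq fract"
type_synonym ZMq = "Zq poly"
type_synonym QMq = "ZMq fract"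

text \<open>
  An operator \<open>\<Sum>\<^sub>i a\<^sub>i L\<^sup>i\<close>, with the coefficients to the left of the powers of \<open>L\<close>, is represented
  by the polynomial in \<open>L\<close> with coefficients \<open>a\<^sub>i\<close>. Only the additive structure and left scalar
  multiplication of \<^typ>\<open>'a poly\<close> are those of the operators: their product is \<open>wloc_mult\<close> below,
  not \<open>(*)\<close>.
\<close>

type_synonym wloc = "QMq poly"
type_synonym weyl = "ZMq poly"

definition qvar :: Qq where
  "qvar = to_fract [:0, 1:]"

text \<open>The value \<open>a(q\<^sup>n, q)\<close>, for \<open>a \<in> \<int>[M,q]\<close> and for \<open>a \<in> \<rat>(M,q)\<close>. For the latter, a fixed
  \<open>a\<close> has only finitely many \<open>n\<close> at which the reduced denominator vanishes (there the value is
  the junk value 0).\<close>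

definition eval_ZMq :: "nat \<Rightarrow> ZMq \<Rightarrow> Qq" where
  "eval_ZMq n a = poly (map_poly to_fract a) (qvar ^ n)"

definition eval_QMq :: "nat \<Rightarrow> QMq \<Rightarrow> Qq" where
  "eval_QMq n a = eval_ZMq n (fst (quot_of_fract a)) / eval_ZMq n (snd (quot_of_fract a))"

definition q_holonomic :: "(nat \<Rightarrow> Qq) \<Rightarrow> bool" where
  "q_holonomic f \<longleftrightarrow> (\<exists>(d::nat) (a :: nat \<Rightarrow> ZMq). a d \<noteq> 0 \<and>
      (\<forall>n. (\<Sum>i\<le>d. eval_ZMq n (a i) * f (n + i)) = 0))"


subsection \<open>The localized \<open>q\<close>-Weyl algebra\<close>

text \<open>The automorphism \<open>a(M,q) \<mapsto> a(Mq,q)\<close>.\<close>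

definition qshift_ZMq :: "ZMq \<Rightarrow> ZMq" where
  "qshift_ZMq a = pcompose a [:0, [:0, 1:]:]"

definition qshift :: "QMq \<Rightarrow> QMq" where
  "qshift a = Fract (qshift_ZMq (fst (quot_of_fract a))) (qshift_ZMq (snd (quot_of_fract a)))"

text \<open>\<open>(a L\<^sup>i) (b L\<^sup>j) = a \<sigma>\<^sup>i(b) L\<^sup>i\<^sup>+\<^sup>j\<close>, where \<open>\<sigma>\<close> is \<open>qshift\<close>.\<close>

definition wloc_mult :: "wloc \<Rightarrow> wloc \<Rightarrow> wloc" where
  "wloc_mult P Q = (\<Sum>i\<le>degree P. \<Sum>j\<le>degree Q.
      monom (coeff P i * (qshift ^^ i) (coeff Q j)) (i + j))"

definition wloc_act :: "wloc \<Rightarrow> (nat \<Rightarrow> Qq) \<Rightarrow> nat \<Rightarrow> Qq" where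
  "wloc_act P f n = (\<Sum>i\<le>degree P. eval_QMq n (coeff P i) * f (n + i))"

definition ann_ideal :: "(nat \<Rightarrow> Qq) \<Rightarrow> wloc set" where
  "ann_ideal f = {P. \<forall>\<^sub>F n in sequentially. wloc_act P f n = 0}"

definition monic_generator :: "wloc set \<Rightarrow> wloc \<Rightarrow> bool" where
  "monic_generator I P \<longleftrightarrow> lead_coeff P = 1 \<and> I = {wloc_mult Q P | Q. True}"

text \<open>\<open>Polynomial.content\<close> is the greatest common divisor in \<open>\<int>[M,q]\<close> of the coefficients
  \<open>a\<^sub>i(M,q)\<close>. The annihilator is unique up to sign, whence a relation.\<close>

definition homogeneous_annihilator :: "(nat \<Rightarrow> Qq) \<Rightarrow> weyl \<Rightarrow> bool" where
  "homogeneous_annihilator f P \<longleftrightarrow>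
     (\<exists>P' c. monic_generator (ann_ideal f) P' \<and> c \<noteq> 0 \<and> map_poly to_fract P = smult c P') \<and>
     Polynomial.content P = 1"


subsection \<open>The Newton polygon and its slopes\<close>

definition newton_polygon0 :: "weyl \<Rightarrow> (real \<times> real) set" where
  "newton_polygon0 P = convex hull
     {(real i, real j) | i j k. coeff (coeff (coeff P i) j) k \<noteq> 0}"

definition slope :: "real \<times> real \<Rightarrow> real \<times> real \<Rightarrow> ereal" where
  "slope u v = (if fst u = fst v then \<infinity> else ereal ((snd u - snd v) / (fst u - fst v)))"

definition polygon_slopes :: "(real \<times> real) set \<Rightarrow> ereal set" where
  "polygon_slopes N = {slope u v | u v. u \<noteq> v \<and> closed_segment u v edge_of N}"


subsection \<open>The slopes of a sequence\<close>

definition deg_q :: "Qq \<Rightarrow> int" where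
  "deg_q r = int (degree (fst (quot_of_fract r))) - int (degree (snd (quot_of_fract r)))"

definition periodic :: "(nat \<Rightarrow> rat) \<Rightarrow> bool" where
  "periodic g \<longleftrightarrow> (\<exists>N>0. \<forall>n. g (n + N) = g n)"

definition qqp_coeffs :: "(nat \<Rightarrow> rat) \<Rightarrow> (nat \<Rightarrow> rat) \<Rightarrow> (nat \<Rightarrow> rat) \<Rightarrow> (nat \<Rightarrow> rat) \<Rightarrow> bool" where
  "qqp_coeffs p g2 g1 g0 \<longleftrightarrow> periodic g2 \<and> periodic g1 \<and> periodic g0 \<and>
     (\<forall>n. p n = g2 n * of_nat (n choose 2) + g1 n * of_nat n + g0 n)"

definition qqp_slopes :: "(nat \<Rightarrow> rat) \<Rightarrow> rat set" where
  "qqp_slopes p = {s. \<exists>g2 g1 g0. qqp_coeffs p g2 g1 g0 \<and> s \<in> range g2}"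

text \<open>For a quadratic quasi-polynomial \<open>p\<close> that agrees with the degree for large \<open>n\<close>, this is the
  set of values of its \<open>\<gamma>\<^sub>2\<close>; see \<open>seq_slopes_eq\<close> below.\<close>

definition seq_slopes :: "(nat \<Rightarrow> Qq) \<Rightarrow> rat set" where
  "seq_slopes f = {s. \<exists>p. (\<forall>\<^sub>F n in sequentially. of_int (deg_q (f n)) = p n) \<and>
     s \<in> qqp_slopes p}"


subsection \<open>Independence of the chosen representations\<close>

lemma quot_of_fract_Fract:
  fixes a b :: "'a :: {ring_gcd,idom_divide,semiring_gcd_mult_normalize}"
  assumes "b \<noteq> 0"
  obtains d where "d \<noteq> 0" "a = fst (quot_of_fract (Fract a b)) * d"
    "b = snd (quot_of_fract (Fract a b)) * d"
proof -
  have "quot_of_fract (Fract a b) = normalize_quot (a, b)"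
    using assms by (metis quot_of_fract_quot_to_fract quot_to_fract_def prod.case snd_conv)
  with normalize_quotE[OF assms, of a] that show ?thesis by metis
qed

lemma deg_q_Fract:
  assumes "a \<noteq> 0" "b \<noteq> 0"
  shows "deg_q (Fract a b) = int (degree a) - int (degree b)"
proof -
  obtain d where d: "d \<noteq> 0" "a = fst (quot_of_fract (Fract a b)) * d"
    "b = snd (quot_of_fract (Fract a b)) * d"
    using quot_of_fract_Fract[OF assms(2)] by metis
  have "fst (quot_of_fract (Fract a b)) \<noteq> 0" "snd (quot_of_fract (Fract a b)) \<noteq> 0"
    using d assms by auto
  then have "degree a = degree (fst (quot_of_fract (Fract a b))) + degree d"
    "degree b = degree (snd (quot_of_fract (Fract a b))) + degree d"
    using d degree_mult_eq by metis+
  then show ?thesis by (simp add: deg_q_def)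
qed

lemma eval_ZMq_mult: "eval_ZMq n (a * b) = eval_ZMq n a * eval_ZMq n b"
  by (simp add: eval_ZMq_def)

lemma eval_QMq_Fract:
  assumes "eval_ZMq n v \<noteq> 0"
  shows "eval_QMq n (Fract u v) = eval_ZMq n u / eval_ZMq n v"
proof -
  have "v \<noteq> 0" using assms by (auto simp: eval_ZMq_def)
  then obtain d where "u = fst (quot_of_fract (Fract u v)) * d"
    "v = snd (quot_of_fract (Fract u v)) * d"
    using quot_of_fract_Fract by metis
  then have *: "eval_ZMq n u = eval_ZMq n (fst (quot_of_fract (Fract u v))) * eval_ZMq n d"
    "eval_ZMq n v = eval_ZMq n (snd (quot_of_fract (Fract u v))) * eval_ZMq n d"
    using eval_ZMq_mult by metis+
  with assms show ?thesis by (simp add: eval_QMq_def)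
qed

lemma qshift_Fract:
  assumes "v \<noteq> 0"
  shows "qshift (Fract u v) = Fract (qshift_ZMq u) (qshift_ZMq v)"
proof -
  obtain d where d: "d \<noteq> 0" "u = fst (quot_of_fract (Fract u v)) * d"
    "v = snd (quot_of_fract (Fract u v)) * d"
    using quot_of_fract_Fract[OF assms] by metis
  define a where "a = fst (quot_of_fract (Fract u v))"
  define b where "b = snd (quot_of_fract (Fract u v))"
  have uv: "u = a * d" "v = b * d" unfolding a_def b_def using d by simp_all
  have nz: "qshift_ZMq x \<noteq> 0" if "x \<noteq> 0" for x
    using that by (simp add: qshift_ZMq_def pcompose_eq_0_iff)
  have mult: "qshift_ZMq (x * y) = qshift_ZMq x * qshift_ZMq y" for x y
    by (simp add: qshift_ZMq_def pcompose_mult)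
  have "b \<noteq> 0" using assms uv by auto
  with d(1) have "Fract (qshift_ZMq a) (qshift_ZMq b) = Fract (qshift_ZMq u) (qshift_ZMq v)"
    by (simp add: uv mult nz eq_fract ac_simps)
  then show ?thesis by (simp add: qshift_def a_def b_def)
qed

lemma eval_qshift_ZMq: "eval_ZMq n (qshift_ZMq a) = eval_ZMq (Suc n) a"
proof (induction a)
  case (pCons c a)
  have *: "qshift_ZMq (pCons c a) = [:c:] + [:0, [:0, 1:]:] * qshift_ZMq a"
    by (simp add: qshift_ZMq_def pcompose_pCons)
  have add: "eval_ZMq n (x + y) = eval_ZMq n x + eval_ZMq n y" for x y
    by (simp add: eval_ZMq_def)
  have "eval_ZMq n [:c:] = to_fract c" "eval_ZMq n [:0, [:0, 1:]:] = qvar ^ Suc n"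
    by (simp_all add: eval_ZMq_def map_poly_pCons qvar_def)
  moreover have "eval_ZMq (Suc n) (pCons c a) = to_fract c + qvar ^ Suc n * eval_ZMq (Suc n) a"
    by (simp add: eval_ZMq_def map_poly_pCons)
  ultimately show ?case using pCons.IH by (simp only: * add eval_ZMq_mult)
qed (simp add: eval_ZMq_def qshift_ZMq_def)

lemma eval_qshift:
  assumes "eval_ZMq (Suc n) (snd (quot_of_fract a)) \<noteq> 0"
  shows "eval_QMq n (qshift a) = eval_QMq (Suc n) a"
  using assms unfolding qshift_def
  by (subst eval_QMq_Fract) (simp_all add: eval_qshift_ZMq eval_QMq_def)

lemma periodic_mult:
  fixes g :: "nat \<Rightarrow> rat"
  assumes "\<forall>n. g (n + N) = g n"
  shows "g (n + N * k) = g n"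
proof (induction k)
  case (Suc k)
  have "g (n + N * Suc k) = g (n + N * k + N)" by (simp add: algebra_simps)
  with assms Suc.IH show ?case by simp
qed simp

lemma seq_slopes_eq:
  assumes p: "qqp_coeffs p g2 g1 g0"
    and f: "\<forall>\<^sub>F n in sequentially. of_int (deg_q (f n)) = p n"
  shows "seq_slopes f = range g2"
proof -
  have "h2 = g2" if h: "qqp_coeffs r h2 h1 h0"
    and r: "\<forall>\<^sub>F n in sequentially. of_int (deg_q (f n)) = r n" for r h2 h1 h0
  proof
    fix n
    from p h have per: "periodic g2" "periodic g1" "periodic g0"
      "periodic h2" "periodic h1" "periodic h0" by (auto simp: qqp_coeffs_def)
    then obtain A B C D E F where pos: "A > 0" "B > 0" "C > 0" "D > 0" "E > 0" "F > 0"
      and per': "\<forall>n. g2 (n + A) = g2 n" "\<forall>n. g1 (n + B) = g1 n" "\<forall>n. g0 (n + C) = g0 n"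
      "\<forall>n. h2 (n + D) = h2 n" "\<forall>n. h1 (n + E) = h1 n" "\<forall>n. h0 (n + F) = h0 n"
      unfolding periodic_def by metis
    define N where "N = A * B * C * D * E * F"
    have N: "N > 0" using pos by (simp add: N_def)
    have inv: "g2 (n + N * k) = g2 n" "g1 (n + N * k) = g1 n" "g0 (n + N * k) = g0 n"
      "h2 (n + N * k) = h2 n" "h1 (n + N * k) = h1 n" "h0 (n + N * k) = h0 n" for k
      using periodic_mult[OF per'(1), of n "B * C * D * E * F * k"]
        periodic_mult[OF per'(2), of n "A * C * D * E * F * k"]
        periodic_mult[OF per'(3), of n "A * B * D * E * F * k"]
        periodic_mult[OF per'(4), of n "A * B * C * E * F * k"]
        periodic_mult[OF per'(5), of n "A * B * C * D * F * k"]
        periodic_mult[OF per'(6), of n "A * B * C * D * E * k"]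
      by (simp_all add: N_def ac_simps)
    from f r have "\<forall>\<^sub>F n in sequentially. p n = r n" by eventually_elim simp
    then obtain n0 where n0: "\<And>m. m \<ge> n0 \<Longrightarrow> p m = r m"
      by (auto simp: eventually_sequentially)
    have eq: "(g2 n - h2 n) * (of_nat (n + N * k) * (of_nat (n + N * k) - 1) / 2)
      + (g1 n - h1 n) * of_nat (n + N * k) + (g0 n - h0 n) = 0" if "k \<ge> n0" for k
    proof -
      have "k \<le> N * k" using N by simp
      then have "n + N * k \<ge> n0" using that by linarith
      then have "p (n + N * k) = r (n + N * k)" by (rule n0)
      then have "g2 n * of_nat ((n + N * k) choose 2) + g1 n * of_nat (n + N * k) + g0 n
        = h2 n * of_nat ((n + N * k) choose 2) + h1 n * of_nat (n + N * k) + h0 n"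
        using p h by (simp only: qqp_coeffs_def inv)
      moreover have ch: "of_nat (m choose 2) = (of_nat m * (of_nat m - 1) / 2 :: rat)" for m
        by (simp add: binomial_gbinomial gbinomial_prod_rev numeral_2_eq_2)
      ultimately show ?thesis unfolding ch by (simp only: left_diff_distrib)
    qed
    define x :: rat where "x = of_nat (n + N * n0)"
    define y :: rat where "y = of_nat N"
    have e1: "of_nat (n + N * Suc n0) = x + y"
      and e2: "of_nat (n + N * Suc (Suc n0)) = x + 2 * y"
      by (simp_all add: x_def y_def algebra_simps)
    have "(u * ((x + 2 * y) * (x + 2 * y - 1) / 2) + v * (x + 2 * y) + w)
      - 2 * (u * ((x + y) * (x + y - 1) / 2) + v * (x + y) + w)
      + (u * (x * (x - 1) / 2) + v * x + w) = u * y\<^sup>2" for u v w :: rat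
      by (simp add: field_simps power2_eq_square)
    from this[of "g2 n - h2 n" "g1 n - h1 n" "g0 n - h0 n"]
    have "(g2 n - h2 n) * y\<^sup>2 = 0"
      using eq[of n0, folded x_def] eq[of "Suc n0", unfolded e1]
        eq[of "Suc (Suc n0)", unfolded e2] by (simp only: le_SucI order_refl mult_zero_right diff_zero add_0_right simp_thms)
    with N show "h2 n = g2 n" by (simp add: y_def)
  qed
  with p f show ?thesis unfolding seq_slopes_def qqp_slopes_def by blast
qed

end

theory Submission
  imports Defs "HOL-Computational_Algebra.Formal_Power_Series"
begin

text \<open>
  Write \<open>K = \<rat>(M,q)\<close>, let \<open>R = K\<langle>L\<rangle>\<close> be the ring of operators, and let \<open>s = \<gamma>\<^sub>2(r)\<close>. Suppose that
  \<open>-s\<close> is not the slope of an edge. Then the linear form \<open>(i, j) \<mapsto> j + s i\<close> attains its maximum on the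
  polygon at one vertex only: otherwise the face on which it is maximal would be an edge of slope
  \<open>-s\<close> (\<open>slope_or_unique_maximum\<close>). So, with the weight \<open>2\<^bsup>deg a + s i\<^esup>\<close> of a term \<open>a L\<^sup>i\<close>, one term of
  \<open>P\<close> outweighs all others; call such an operator dominant.

  Let \<open>N\<close> be a common period of the coefficients of the quasi-polynomial. If \<open>Q\<close> is dominant,
  annihilates \<open>f\<close>, and involves only powers of \<open>L\<^sup>N\<close>, then \<open>(Q f)\<^sub>n\<close> with \<open>n \<equiv> r\<close> modulo \<open>N\<close> involves only
  members of \<open>f\<close> whose degrees are given by one and the same quadratic polynomial. Shifting that
  polynomial by \<open>j\<close> adds \<open>s j n + O(1)\<close>, and the value \<open>a(q\<^sup>n, q)\<close> has degree \<open>n deg a + O(1)\<close>, so for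
  large \<open>n\<close> the degrees of the summands are ordered by the weights of the terms of \<open>Q\<close>. The
  heaviest summand cannot cancel: a contradiction (\<open>sparse_dominant_not_annihilating\<close>).
  The degrees alone do not give this for \<open>P\<close> in place of \<open>Q\<close>, because \<open>\<gamma>\<^sub>2\<close> may take larger values
  in other residue classes, whose members then hide those of the class of \<open>r\<close>.

  It remains to find a left multiple \<open>Q = A P\<close> in the subring \<open>R\<^sub>N = K\<langle>L\<^sup>N\<rangle>\<close> that is again dominant
  (\<open>dominant_sparse_multiple\<close>). Since \<open>R/RP\<close> has finite dimension over \<open>K\<close>, nonzero multiples in
  \<open>R\<^sub>N\<close> exist; choose \<open>A\<close> of minimal degree. Write \<open>A = \<Sum>\<^sub>i A\<^sub>i L\<^sup>i\<close> with \<open>i < N\<close> and \<open>A\<^sub>i \<in> R\<^sub>N\<close>. A common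
  left factor of the \<open>A\<^sub>i\<close> could be cancelled, so minimality and the Euclidean algorithm in \<open>R\<^sub>N\<close> give
  \<open>\<Sum>\<^sub>i A\<^sub>i v\<^sub>i = g\<close> with \<open>g \<in> K\<close> nonzero (\<open>primitive_cofactor_exists\<close>). On the other hand a dominant
  operator can be inverted approximately by a geometric series: \<open>P Y = L\<^sup>k - E\<close> with \<open>E\<close> as
  light as desired (\<open>approximate_right_division\<close>). Hence \<open>Q Y = A L\<^sup>k - A E\<close>; combining the
  components of both sides with the coefficients \<open>v\<^sub>i\<close> turns this into \<open>Q z = g L\<^sup>k - F\<close> with \<open>F\<close> light.
  The right side is dominant, and a left factor of a dominant operator is dominant, as in Gauss's
  lemma (\<open>dominant_left_factor\<close>).
\<close>

section \<open>Skew polynomials over a difference field\<close>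

locale difference_field =
  fixes \<sigma> :: "'k::field \<Rightarrow> 'k"
  assumes hom_add: "\<sigma> (a + b) = \<sigma> a + \<sigma> b"
    and hom_mult: "\<sigma> (a * b) = \<sigma> a * \<sigma> b"
    and hom_one: "\<sigma> 1 = 1"
    and surj_hom: "surj \<sigma>"
begin

lemma pow_add: "(\<sigma> ^^ i) (a + b) = (\<sigma> ^^ i) a + (\<sigma> ^^ i) b"
  by (induction i) (simp_all add: hom_add)

lemma pow_mult: "(\<sigma> ^^ i) (a * b) = (\<sigma> ^^ i) a * (\<sigma> ^^ i) b"
  by (induction i) (simp_all add: hom_mult)

lemma pow_one [simp]: "(\<sigma> ^^ i) 1 = 1"
  by (induction i) (simp_all add: hom_one)

lemma pow_zero [simp]: "(\<sigma> ^^ i) 0 = 0"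
proof (induction i)
  case (Suc i)
  have "\<sigma> 0 = 0" using hom_add[of 0 0] by (metis add.right_neutral add_left_cancel)
  with Suc show ?case by simp
qed simp

lemma pow_minus: "(\<sigma> ^^ i) (- a) = - (\<sigma> ^^ i) a"
  using pow_add[of i a "- a"] by (simp add: minus_unique)

lemma pow_diff: "(\<sigma> ^^ i) (a - b) = (\<sigma> ^^ i) a - (\<sigma> ^^ i) b"
  using pow_add[of i a "- b"] by (simp add: pow_minus)

lemma pow_sum: "(\<sigma> ^^ i) (sum g A) = (\<Sum>x\<in>A. (\<sigma> ^^ i) (g x))"
  by (induction A rule: infinite_finite_induct) (simp_all add: pow_add)

lemma pow_eq_0_iff [simp]: "(\<sigma> ^^ i) a = 0 \<longleftrightarrow> a = 0"
proof
  assume "(\<sigma> ^^ i) a = 0"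
  then have "(\<sigma> ^^ i) (a * inverse a) = 0" by (simp add: pow_mult)
  then show "a = 0" by (cases "a = 0") auto
qed simp

lemma pow_pow: "(\<sigma> ^^ i) ((\<sigma> ^^ j) a) = (\<sigma> ^^ (i + j)) a"
  by (simp add: funpow_add)

lemma pow_surj: obtains b where "(\<sigma> ^^ i) b = a"
proof -
  have "surj (\<sigma> ^^ i)"
  proof (induction i)
    case (Suc i)
    then show ?case unfolding funpow.simps(2) using surj_hom by (rule comp_surj)
  qed (simp add: surj_def)
  with that show ?thesis by (metis surjD)
qed

text \<open>The product of the skew polynomial ring \<open>K\<langle>L\<rangle>\<close> with \<open>L a = \<sigma>(a) L\<close>.\<close>
definition skew_mult :: "'k poly \<Rightarrow> 'k poly \<Rightarrow> 'k poly" (infixl "\<star>" 70) where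
  "p \<star> q = (\<Sum>i\<le>degree p. \<Sum>j\<le>degree q.
      monom (coeff p i * (\<sigma> ^^ i) (coeff q j)) (i + j))"

lemma coeff_skew_mult:
  "coeff (p \<star> q) n = (\<Sum>i\<le>n. coeff p i * (\<sigma> ^^ i) (coeff q (n - i)))"
proof -
  have "(\<Sum>j\<le>degree q. coeff (monom (coeff p i * (\<sigma> ^^ i) (coeff q j)) (i + j)) n)
      = (if i \<le> n then coeff p i * (\<sigma> ^^ i) (coeff q (n - i)) else 0)" for i
  proof (cases "i \<le> n")
    case True
    then have "i + j = n \<longleftrightarrow> j = n - i" for j by auto
    then have "(\<Sum>j\<le>degree q. coeff (monom (coeff p i * (\<sigma> ^^ i) (coeff q j)) (i + j)) n)
      = (\<Sum>j\<le>degree q. if j = n - i then coeff p i * (\<sigma> ^^ i) (coeff q j) else 0)"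
      by (intro sum.cong) simp_all
    with True show ?thesis
      by (auto simp: sum.delta not_le coeff_eq_0)
  qed simp
  then have "coeff (p \<star> q) n
      = (\<Sum>i\<le>degree p. if i \<le> n then coeff p i * (\<sigma> ^^ i) (coeff q (n - i)) else 0)"
    by (simp add: skew_mult_def coeff_sum)
  also have "\<dots> = (\<Sum>i\<le>max n (degree p). if i \<le> n then coeff p i * (\<sigma> ^^ i) (coeff q (n - i)) else 0)"
    by (rule sum.mono_neutral_left) (auto simp: coeff_eq_0)
  also have "\<dots> = (\<Sum>i\<le>n. if i \<le> n then coeff p i * (\<sigma> ^^ i) (coeff q (n - i)) else 0)"
    by (rule sum.mono_neutral_right) auto
  finally show ?thesis by simp
qed

lemma skew_add_left: "(p + q) \<star> r = p \<star> r + q \<star> r"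
  by (rule poly_eqI) (simp add: coeff_skew_mult distrib_right sum.distrib)

lemma skew_add_right: "p \<star> (q + r) = p \<star> q + p \<star> r"
  by (rule poly_eqI) (simp add: coeff_skew_mult pow_add distrib_left sum.distrib)

lemma skew_diff_left: "(p - q) \<star> r = p \<star> r - q \<star> r"
  by (rule poly_eqI) (simp add: coeff_skew_mult left_diff_distrib sum_subtractf)

lemma skew_diff_right: "p \<star> (q - r) = p \<star> q - p \<star> r"
  by (rule poly_eqI) (simp add: coeff_skew_mult pow_diff right_diff_distrib sum_subtractf)

lemma skew_zero_left [simp]: "0 \<star> q = 0"
  by (rule poly_eqI) (simp add: coeff_skew_mult)

lemma skew_zero_right [simp]: "p \<star> 0 = 0"
  by (rule poly_eqI) (simp add: coeff_skew_mult)

lemma skew_sum_left: "sum g A \<star> q = (\<Sum>x\<in>A. g x \<star> q)"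
  by (induction A rule: infinite_finite_induct) (simp_all add: skew_add_left)

lemma skew_sum_right: "p \<star> sum g A = (\<Sum>x\<in>A. p \<star> g x)"
  by (induction A rule: infinite_finite_induct) (simp_all add: skew_add_right)

lemma skew_smult_left: "smult a p \<star> q = smult a (p \<star> q)"
  by (rule poly_eqI) (simp add: coeff_skew_mult sum_distrib_left mult.assoc)

lemma skew_assoc: "(p \<star> q) \<star> r = p \<star> (q \<star> r)"
proof (rule poly_eqI)
  fix n
  have "coeff ((p \<star> q) \<star> r) n = (\<Sum>j=0..n. \<Sum>i=0..j.
      coeff p i * (\<sigma> ^^ i) (coeff q (j - i)) * (\<sigma> ^^ (i + (j - i))) (coeff r (n - j)))"
    by (simp add: coeff_skew_mult sum_distrib_right atMost_atLeast0)
  also have "\<dots> = (\<Sum>j=0..n. \<Sum>i=0..n - j.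
      coeff p j * (\<sigma> ^^ j) (coeff q i) * (\<sigma> ^^ (j + i)) (coeff r (n - j - i)))"
    by (rule fps_mult_assoc_lemma
        [of "\<lambda>i k l. coeff p i * (\<sigma> ^^ i) (coeff q k) * (\<sigma> ^^ (i + k)) (coeff r l)"])
  also have "\<dots> = coeff (p \<star> (q \<star> r)) n"
    by (simp add: coeff_skew_mult pow_sum pow_mult pow_pow sum_distrib_left atMost_atLeast0 mult.assoc)
  finally show "coeff ((p \<star> q) \<star> r) n = coeff (p \<star> (q \<star> r)) n" .
qed

lemma coeff_monom_skew:
  "coeff (monom a m \<star> q) n = (if m \<le> n then a * (\<sigma> ^^ m) (coeff q (n - m)) else 0)"
proof -
  have "coeff (monom a m \<star> q) n
      = (\<Sum>i\<le>n. if i = m then a * (\<sigma> ^^ m) (coeff q (n - m)) else 0)"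
    unfolding coeff_skew_mult by (intro sum.cong) auto
  then show ?thesis by (simp add: sum.delta)
qed

lemma coeff_skew_monom:
  "coeff (p \<star> monom b m) n = (if m \<le> n then coeff p (n - m) * (\<sigma> ^^ (n - m)) b else 0)"
proof -
  have "coeff (p \<star> monom b m) n
      = (\<Sum>i\<le>n. if i = n - m \<and> m \<le> n then coeff p (n - m) * (\<sigma> ^^ (n - m)) b else 0)"
    unfolding coeff_skew_mult by (intro sum.cong) auto
  then show ?thesis by (auto simp: sum.delta)
qed

lemma skew_one_right [simp]: "p \<star> 1 = p"
  using coeff_skew_monom[of p 1 0] by (simp add: poly_eq_iff)

lemma coeff_skew_degree_sum:
  "coeff (p \<star> q) (degree p + degree q) = lead_coeff p * (\<sigma> ^^ degree p) (lead_coeff q)"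
proof -
  have "coeff p i * (\<sigma> ^^ i) (coeff q (degree p + degree q - i))
      = (if i = degree p then lead_coeff p * (\<sigma> ^^ degree p) (lead_coeff q) else 0)" for i
    by (cases i "degree p" rule: linorder_cases) (simp_all add: coeff_eq_0)
  then show ?thesis by (simp add: coeff_skew_mult)
qed

lemma skew_no_zero_divisors:
  assumes "p \<noteq> 0" "q \<noteq> 0" shows "p \<star> q \<noteq> 0"
  using assms coeff_skew_degree_sum[of p q] by auto

lemma skew_eq_0_iff [simp]: "p \<star> q = 0 \<longleftrightarrow> p = 0 \<or> q = 0"
  using skew_no_zero_divisors by auto

lemma degree_skew_mult:
  assumes "p \<noteq> 0" "q \<noteq> 0" shows "degree (p \<star> q) = degree p + degree q"
proof (rule antisym)
  show "degree (p \<star> q) \<le> degree p + degree q"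
  proof (rule degree_le, intro allI impI)
    fix n assume "degree p + degree q < n"
    then have "coeff p i * (\<sigma> ^^ i) (coeff q (n - i)) = 0" for i
      by (cases "i \<le> degree p") (simp_all add: coeff_eq_0)
    then show "coeff (p \<star> q) n = 0" unfolding coeff_skew_mult by (intro sum.neutral ballI)
  qed
  show "degree p + degree q \<le> degree (p \<star> q)"
    using assms by (intro le_degree) (simp add: coeff_skew_degree_sum)
qed

lemma left_division:
  assumes "P \<noteq> 0"
  obtains A where "\<And>i. degree P \<le> i \<Longrightarrow> coeff (B - A \<star> P) i = 0"
proof -
  have "\<exists>A. \<forall>i\<ge>degree P. coeff (B - A \<star> P) i = 0" if "\<And>i. n \<le> i \<Longrightarrow> coeff B i = 0" for n
    using that
  proof (induction n arbitrary: B)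
    case 0
    then show ?case by (intro exI[of _ 0]) simp
  next
    case (Suc n)
    show ?case
    proof (cases "n < degree P")
      case True
      with Suc.prems show ?thesis by (intro exI[of _ 0]) simp
    next
      case False
      define m where "m = n - degree P"
      define C where "C = monom (coeff B n / (\<sigma> ^^ m) (lead_coeff P)) m"
      have "coeff (B - C \<star> P) i = 0" if "n \<le> i" for i
      proof (cases "i = n")
        case True
        with False assms show ?thesis by (simp add: C_def coeff_monom_skew m_def)
      next
        case *: False
        with that have "coeff B i = 0" by (intro Suc.prems) simp
        with that * False show ?thesis
          by (simp add: C_def coeff_monom_skew m_def coeff_eq_0)
      qed
      from Suc.IH[OF this] obtain A where "\<forall>i\<ge>degree P. coeff (B - C \<star> P - A \<star> P) i = 0"
        by blast
      then show ?thesis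
        by (intro exI[of _ "C + A"]) (simp add: skew_add_left diff_diff_eq)
    qed
  qed
  from this[of "Suc (degree B)"] that show ?thesis by (auto simp: coeff_eq_0)
qed

section \<open>The subring of operators in a power of the shift\<close>

text \<open>The elements of \<open>K\<langle>L\<^sup>N\<rangle>\<close>.\<close>
definition sparse :: "nat \<Rightarrow> 'k poly \<Rightarrow> bool" where
  "sparse N p \<longleftrightarrow> (\<forall>i. \<not> N dvd i \<longrightarrow> coeff p i = 0)"

lemma sparse_zero [simp]: "sparse N 0"
  by (simp add: sparse_def)

lemma sparse_diff: "sparse N p \<Longrightarrow> sparse N q \<Longrightarrow> sparse N (p - q)"
  by (simp add: sparse_def)

lemma sparse_add: "sparse N p \<Longrightarrow> sparse N q \<Longrightarrow> sparse N (p + q)"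
  by (simp add: sparse_def)

lemma sparse_smult: "sparse N p \<Longrightarrow> sparse N (smult a p)"
  by (simp add: sparse_def)

lemma sparse_sum: "(\<And>x. x \<in> A \<Longrightarrow> sparse N (g x)) \<Longrightarrow> sparse N (sum g A)"
  by (induction A rule: infinite_finite_induct) (simp_all add: sparse_add)

lemma sparse_monom: "N dvd m \<Longrightarrow> sparse N (monom a m)"
  by (auto simp: sparse_def)

lemma sparse_one [simp]: "sparse N 1"
  using sparse_monom[of N 0 1] by simp

lemma sparse_skew_mult: "sparse N p \<Longrightarrow> sparse N q \<Longrightarrow> sparse N (p \<star> q)"
  unfolding sparse_def coeff_skew_mult
proof (intro allI impI sum.neutral ballI)
  fix n i
  assume *: "\<forall>i. \<not> N dvd i \<longrightarrow> coeff p i = 0" "\<forall>i. \<not> N dvd i \<longrightarrow> coeff q i = 0"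
    "\<not> N dvd n" "i \<in> {..n}"
  then have "\<not> N dvd i \<or> \<not> N dvd n - i" by (metis atMost_iff dvd_add le_add_diff_inverse)
  with * show "coeff p i * (\<sigma> ^^ i) (coeff q (n - i)) = 0" by auto
qed

lemma dvd_degree_sparse: "sparse N p \<Longrightarrow> p \<noteq> 0 \<Longrightarrow> N dvd degree p"
  by (metis leading_coeff_0_iff sparse_def)

text \<open>Here the surjectivity of \<open>\<sigma>\<close> enters: to cancel a leading coefficient by a multiplication from
  the right, the inverse of a power of \<open>\<sigma>\<close> is applied to a quotient of coefficients.\<close>
lemma right_division_sparse:
  assumes g: "g \<noteq> 0" "sparse N g" and "sparse N u"
  obtains x where "sparse N x" "\<And>i. degree g \<le> i \<Longrightarrow> coeff (u - g \<star> x) i = 0"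
proof -
  have "\<exists>x. sparse N x \<and> (\<forall>i\<ge>degree g. coeff (u - g \<star> x) i = 0)"
    if "\<And>i. n \<le> i \<Longrightarrow> coeff u i = 0" "sparse N u" for n
    using that
  proof (induction n arbitrary: u)
    case 0
    then show ?case by (intro exI[of _ 0]) simp
  next
    case (Suc n)
    show ?case
    proof (cases "n < degree g \<or> coeff u n = 0")
      case True
      then show ?thesis
      proof
        assume "n < degree g"
        with Suc.prems show ?thesis by (intro exI[of _ 0]) simp
      next
        assume "coeff u n = 0"
        then have "coeff u i = 0" if "n \<le> i" for i
          using Suc.prems(1)[of i] that by (cases "i = n") auto
        from Suc.IH[OF this Suc.prems(2)] show ?thesis by blast
      qed
    next
      case False
      define m where "m = n - degree g"
      obtain b where b: "(\<sigma> ^^ degree g) b = coeff u n / lead_coeff g" by (rule pow_surj)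
      have "N dvd n" using False Suc.prems(2) by (auto simp: sparse_def)
      with g have "N dvd m" by (simp add: m_def dvd_degree_sparse)
      then have sp: "sparse N (monom b m)" by (rule sparse_monom)
      have "coeff (u - g \<star> monom b m) i = 0" if "n \<le> i" for i
      proof (cases "i = n")
        case True
        with False g b show ?thesis by (simp add: coeff_skew_monom m_def)
      next
        case *: False
        with that have "coeff u i = 0" by (intro Suc.prems) simp
        with that * False show ?thesis
          by (simp add: coeff_skew_monom m_def coeff_eq_0)
      qed
      moreover have "sparse N (u - g \<star> monom b m)"
        using g sp Suc.prems(2) by (intro sparse_diff sparse_skew_mult)
      ultimately obtain x where
        "sparse N x" "\<forall>i\<ge>degree g. coeff (u - g \<star> monom b m - g \<star> x) i = 0"
        using Suc.IH by blast
      with sp show ?thesis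
        by (intro exI[of _ "monom b m + x"]) (simp add: skew_add_right diff_diff_eq sparse_add)
    qed
  qed
  from this[of "Suc (degree u)"] assms that show ?thesis by (auto simp: coeff_eq_0)
qed

text \<open>As a left module over \<open>K\<langle>L\<^sup>N\<rangle>\<close>, the ring \<open>K\<langle>L\<rangle>\<close> is free with basis \<open>1, L, \<dots>, L\<^bsup>N-1\<^esup>\<close>. The components
  are the coordinates with respect to this basis.\<close>
definition component :: "nat \<Rightarrow> nat \<Rightarrow> 'k poly \<Rightarrow> 'k poly" where
  "component N i p = Abs_poly (\<lambda>j. if N dvd j then coeff p (j + i) else 0)"

lemma coeff_component: "coeff (component N i p) j = (if N dvd j then coeff p (j + i) else 0)"
proof -
  have "\<forall>\<^sub>\<infinity>j. (if N dvd j then coeff p (j + i) else 0) = 0"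
    unfolding MOST_nat by (intro exI[of _ "degree p"]) (simp add: coeff_eq_0)
  then show ?thesis by (simp add: component_def Abs_poly_inverse)
qed

lemma sparse_component: "sparse N (component N i p)"
  by (simp add: sparse_def coeff_component)

lemma component_add: "component N i (p + q) = component N i p + component N i q"
  by (rule poly_eqI) (simp add: coeff_component)

lemma component_zero [simp]: "component N i 0 = 0"
  by (rule poly_eqI) (simp add: coeff_component)

lemma component_skew_mult:
  assumes "sparse N q" "i < N"
  shows "component N i (q \<star> p) = q \<star> component N i p"
proof (rule poly_eqI)
  fix n
  show "coeff (component N i (q \<star> p)) n = coeff (q \<star> component N i p) n"
  proof (cases "N dvd n")
    case True
    have "(\<Sum>l\<le>n + i. coeff q l * (\<sigma> ^^ l) (coeff p (n + i - l)))
        = (\<Sum>l\<le>n. coeff q l * (\<sigma> ^^ l) (coeff (component N i p) (n - l)))"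
    proof (rule sum.mono_neutral_cong_right)
      show "\<forall>l\<in>{..n + i} - {..n}. coeff q l * (\<sigma> ^^ l) (coeff p (n + i - l)) = 0"
      proof
        fix l assume "l \<in> {..n + i} - {..n}"
        then have "0 < l - n" "l - n < N" "n \<le> l" using assms(2) by auto
        then have "\<not> N dvd l" using True by (metis dvd_diff_nat nat_dvd_not_less)
        with assms(1) show "coeff q l * (\<sigma> ^^ l) (coeff p (n + i - l)) = 0"
          by (simp add: sparse_def)
      qed
      fix l assume l: "l \<in> {..n}"
      show "coeff q l * (\<sigma> ^^ l) (coeff p (n + i - l))
          = coeff q l * (\<sigma> ^^ l) (coeff (component N i p) (n - l))"
      proof (cases "N dvd l")
        case *: True
        with True l have "N dvd n - l" by simp
        with l show ?thesis by (simp add: coeff_component)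
      next
        case False
        with assms(1) show ?thesis by (simp add: sparse_def)
      qed
    qed auto
    with True show ?thesis by (simp add: coeff_component coeff_skew_mult)
  next
    case False
    with sparse_skew_mult[OF assms(1) sparse_component, of i p] show ?thesis
      by (simp add: coeff_component sparse_def)
  qed
qed

lemma component_decomposition:
  assumes "N > 0" shows "p = (\<Sum>i<N. component N i p \<star> monom 1 i)"
proof (rule poly_eqI)
  fix n
  have "N dvd n - i \<and> i \<le> n \<longleftrightarrow> i = n mod N" if "i < N" for i
  proof
    assume h: "N dvd n - i \<and> i \<le> n"
    then have "n mod N = i mod N" using mod_eq_dvd_iff_nat by blast
    with that show "i = n mod N" by simp
  qed (auto simp: minus_mod_eq_mult_div)
  then have "coeff (component N i p \<star> monom 1 i) n = (if i = n mod N then coeff p n else 0)"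
    if "i < N" for i using that
    by (auto simp: coeff_component coeff_skew_monom split: if_splits)
  then have "(\<Sum>i<N. coeff (component N i p \<star> monom 1 i) n)
      = (\<Sum>i<N. if i = n mod N then coeff p n else 0)" by (intro sum.cong) auto
  then show "coeff p n = coeff (\<Sum>i<N. component N i p \<star> monom 1 i) n"
    using assms by (simp add: coeff_sum)
qed

lemma sparse_iff_component:
  assumes "N > 0"
  shows "sparse N p \<longleftrightarrow> (\<forall>i. 0 < i \<and> i < N \<longrightarrow> component N i p = 0)"
proof
  assume p: "sparse N p"
  show "\<forall>i. 0 < i \<and> i < N \<longrightarrow> component N i p = 0"
  proof (intro allI impI)
    fix i assume i: "0 < i \<and> i < N"
    have "coeff (component N i p) j = 0" for j
    proof (cases "N dvd j")
      case True
      with i have "\<not> N dvd j + i" by (simp add: dvd_add_right_iff nat_dvd_not_less)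
      with p show ?thesis by (simp add: coeff_component sparse_def)
    qed (simp add: coeff_component)
    then show "component N i p = 0" by (simp add: poly_eq_iff)
  qed
next
  assume *: "\<forall>i. 0 < i \<and> i < N \<longrightarrow> component N i p = 0"
  have "p = (\<Sum>i<N. component N i p \<star> monom 1 i)"
    by (rule component_decomposition[OF assms])
  also have "\<dots> = (\<Sum>i\<in>{0}. component N i p \<star> monom 1 i)"
    using * assms by (intro sum.mono_neutral_right) auto
  finally have "p = component N 0 p \<star> monom 1 0" by simp
  moreover have "sparse N (component N 0 p \<star> monom 1 0)"
    by (intro sparse_skew_mult sparse_component sparse_monom) simp
  ultimately show "sparse N p" by simp
qed

text \<open>The coordinates of \<open>p\<close> at \<open>L, \<dots>, L\<^bsup>N-1\<^esup>\<close> vanish as soon as their multiples by \<open>g\<close> do.\<close>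
lemma sparse_left_factor:
  assumes "N > 0" "sparse N g" "g \<noteq> 0" "sparse N (g \<star> p)"
  shows "sparse N p"
  unfolding sparse_iff_component[OF assms(1)]
proof (intro allI impI)
  fix i assume i: "0 < i \<and> i < N"
  then have "g \<star> component N i p = component N i (g \<star> p)"
    using assms(2) by (simp add: component_skew_mult)
  also have "\<dots> = 0" using i assms(4) sparse_iff_component[OF assms(1)] by blast
  finally show "component N i p = 0" using assms(3) by simp
qed

end

text \<open>Gaussian elimination: with a pivot \<open>r m\<close> for the coefficient at \<open>d\<close>, the other polynomials are
  reduced to degree below \<open>d\<close>.\<close>
lemma polys_linearly_dependent:
  fixes r :: "nat \<Rightarrow> 'a::field poly"
  assumes "\<And>j i. j \<le> d \<Longrightarrow> d \<le> i \<Longrightarrow> coeff (r j) i = 0"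
  obtains x where "\<exists>j\<le>d. x j \<noteq> 0" "(\<Sum>j\<le>d. smult (x j) (r j)) = 0"
proof -
  have "\<exists>x. (\<exists>j\<le>d. x j \<noteq> 0) \<and> (\<Sum>j\<le>d. smult (x j) (r j)) = 0" using assms
  proof (induction d arbitrary: r)
    case 0
    then have "r 0 = 0" by (simp add: poly_eq_iff)
    then show ?case by (intro exI[of _ "\<lambda>_. 1"]) simp
  next
    case (Suc d)
    show ?case
    proof (cases "\<exists>m\<le>Suc d. coeff (r m) d \<noteq> 0")
      case False
      have "coeff (r j) i = 0" if "j \<le> d" "d \<le> i" for i j
        using that False Suc.prems[of j i] by (cases "i = d") auto
      from Suc.IH[of r, OF this] obtain x
        where x: "\<exists>j\<le>d. x j \<noteq> 0" "(\<Sum>j\<le>d. smult (x j) (r j)) = 0" by blast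
      then have "(\<Sum>j\<le>Suc d. smult ((x(Suc d := 0)) j) (r j)) = 0"
        by simp
      moreover from x(1) obtain j where "j \<le> d" "x j \<noteq> 0" by blast
      then have "j \<le> Suc d" "(x(Suc d := 0)) j \<noteq> 0" by auto
      ultimately show ?thesis by blast
    next
      case True
      then obtain m where m: "m \<le> Suc d" "coeff (r m) d \<noteq> 0" by blast
      \<comment> \<open>The enumeration of the indices other than the pivot.\<close>
      define skip where "skip j = (if j < m then j else Suc j)" for j
      define c where "c j = coeff (r (skip j)) d / coeff (r m) d" for j
      have skip_le: "skip j \<le> Suc d" if "j \<le> d" for j using that by (simp add: skip_def)
      have "coeff (r (skip j) - smult (c j) (r m)) i = 0" if "j \<le> d" "d \<le> i" for i j
        using that m Suc.prems[of "skip j" i] Suc.prems[of m i] skip_le[of j]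
        by (cases "i = d") (auto simp: c_def)
      from Suc.IH[of "\<lambda>j. r (skip j) - smult (c j) (r m)", OF this] obtain x
        where x: "\<exists>j\<le>d. x j \<noteq> 0"
          "(\<Sum>j\<le>d. smult (x j) (r (skip j) - smult (c j) (r m))) = 0" by blast
      define y where "y j = (if j = m then - (\<Sum>j\<le>d. x j * c j)
          else x (if j < m then j else j - 1))" for j
      have y_skip: "y (skip j) = x j" for j by (auto simp: y_def skip_def)
      have bij: "bij_betw skip {..d} ({..Suc d} - {m})"
        by (rule bij_betwI[where g = "\<lambda>j. if j < m then j else j - 1"])
          (use m in \<open>auto simp: skip_def split: if_splits\<close>)
      have "(\<Sum>j\<le>Suc d. smult (y j) (r j))
          = smult (y m) (r m) + (\<Sum>j\<in>{..Suc d} - {m}. smult (y j) (r j))"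
        using m by (intro sum.remove) simp_all
      also have "(\<Sum>j\<in>{..Suc d} - {m}. smult (y j) (r j)) = (\<Sum>j\<le>d. smult (x j) (r (skip j)))"
        using sum.reindex_bij_betw[OF bij, of "\<lambda>j. smult (y j) (r j)"] by (simp add: y_skip)
      also have "smult (y m) (r m) + \<dots> = (\<Sum>j\<le>d. smult (x j) (r (skip j) - smult (c j) (r m)))"
        by (simp add: y_def smult_diff_right sum_subtractf smult_sum)
      finally have "(\<Sum>j\<le>Suc d. smult (y j) (r j)) = 0" using x(2) by simp
      moreover from x(1) obtain j where "j \<le> d" "x j \<noteq> 0" by blast
      then have "skip j \<le> Suc d" "y (skip j) \<noteq> 0" by (simp_all add: skip_le y_skip)
      ultimately show ?thesis by blast
    qed
  qed
  with that show ?thesis by blast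
qed

context difference_field
begin

text \<open>The remainders of \<open>1, L\<^sup>N, L\<^bsup>2N\<^esup>, \<dots>\<close> modulo \<open>P\<close> lie in a space of dimension \<open>degree P\<close>, so finitely
  many of them are linearly dependent.\<close>
lemma sparse_left_multiple_exists:
  assumes "P \<noteq> 0" "N > 0"
  obtains A where "A \<noteq> 0" "sparse N (A \<star> P)"
proof -
  have "\<exists>B. \<forall>i\<ge>degree P. coeff (monom 1 (N * j) - B \<star> P) i = 0" for j
    using left_division[OF assms(1)] by metis
  then obtain B where B: "\<And>j i. degree P \<le> i \<Longrightarrow> coeff (monom 1 (N * j) - B j \<star> P) i = 0"
    by metis
  obtain x where x: "\<exists>j\<le>degree P. x j \<noteq> 0"
    "(\<Sum>j\<le>degree P. smult (x j) (monom 1 (N * j) - B j \<star> P)) = 0"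
    by (rule polys_linearly_dependent[of "degree P" "\<lambda>j. monom 1 (N * j) - B j \<star> P"])
      (simp_all only: B)
  define A where "A = (\<Sum>j\<le>degree P. smult (x j) (B j))"
  define Q where "Q = (\<Sum>j\<le>degree P. smult (x j) (monom 1 (N * j)))"
  have "Q - A \<star> P = (\<Sum>j\<le>degree P. smult (x j) (monom 1 (N * j)) - smult (x j) (B j \<star> P))"
    unfolding A_def Q_def skew_sum_left skew_smult_left sum_subtractf ..
  also have "\<dots> = 0" using x(2) unfolding smult_diff_right .
  finally have "A \<star> P = Q" by (metis eq_iff_diff_eq_0)
  moreover have "sparse N Q"
    unfolding Q_def by (intro sparse_sum sparse_smult sparse_monom) simp
  moreover have "Q \<noteq> 0"
  proof -
    from x(1) obtain m where m: "m \<le> degree P" "x m \<noteq> 0" by blast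
    have "coeff Q (N * m) = (\<Sum>j\<le>degree P. if j = m then x m else 0)"
      unfolding Q_def coeff_sum using assms(2) by (intro sum.cong) auto
    with m show ?thesis by auto
  qed
  ultimately show ?thesis using that[of A] by auto
qed

text \<open>A nonzero \<open>A\<close> of minimal degree with \<open>A P\<close> in \<open>K\<langle>L\<^sup>N\<rangle>\<close> has left coprime components, since a common
  left factor \<open>h \<in> K\<langle>L\<^sup>N\<rangle>\<close> may be cancelled from \<open>A P\<close>.\<close>
lemma primitive_cofactor_exists:
  assumes "P \<noteq> 0" "N > 0"
  obtains A v g where "A \<noteq> 0" "sparse N (A \<star> P)" "g \<noteq> 0"
    "(\<Sum>i<N. component N i A \<star> v i) = monom g 0"
proof -
  define good where "good A \<longleftrightarrow> A \<noteq> 0 \<and> sparse N (A \<star> P)" for A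
  have "\<exists>A. good A" unfolding good_def using sparse_left_multiple_exists[OF assms] by metis
  then obtain A where A: "good A" "\<And>B. good B \<Longrightarrow> degree A \<le> degree B"
    using ex_has_least_nat[of good _ degree] by blast
  \<comment> \<open>The nonzero elements of the right ideal of \<open>K\<langle>L\<^sup>N\<rangle>\<close> generated by the components of \<open>A\<close>; an
    element \<open>h\<close> of least degree generates it.\<close>
  define J where "J = {h. h \<noteq> 0 \<and> sparse N h \<and>
    (\<exists>v. (\<forall>i. sparse N (v i)) \<and> (\<Sum>i<N. component N i A \<star> v i) = h)}"
  have comp_in_J: "component N i A \<in> J" if "i < N" "component N i A \<noteq> 0" for i
  proof -
    have "(\<Sum>j<N. component N j A \<star> (if j = i then 1 else 0))
        = (\<Sum>j<N. if j = i then component N i A else 0)"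
      by (intro sum.cong) auto
    also have "\<dots> = component N i A" using that by simp
    finally show ?thesis
      unfolding J_def using that(2)
      by (auto intro!: exI[of _ "\<lambda>j. if j = i then 1 else 0"] sparse_component)
  qed
  have "\<exists>i<N. component N i A \<noteq> 0"
  proof (rule ccontr)
    assume "\<not> ?thesis"
    then have "(\<Sum>i<N. component N i A \<star> monom 1 i) = 0" by simp
    then show False using component_decomposition[OF assms(2), of A] A(1) by (simp add: good_def)
  qed
  then have "\<exists>h. h \<in> J" using comp_in_J by blast
  then obtain h where h: "h \<in> J" "\<And>k. k \<in> J \<Longrightarrow> degree h \<le> degree k"
    using ex_has_least_nat[of "\<lambda>h. h \<in> J" _ degree] by blast
  from h(1) obtain v where v: "\<And>i. sparse N (v i)" "(\<Sum>i<N. component N i A \<star> v i) = h"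
    and h0: "h \<noteq> 0" "sparse N h" by (auto simp: J_def)
  have "\<exists>x. component N i A = h \<star> x" if i: "i < N" for i
  proof -
    obtain x where x: "sparse N x" "\<And>l. degree h \<le> l \<Longrightarrow> coeff (component N i A - h \<star> x) l = 0"
      using right_division_sparse[OF h0 sparse_component] by metis
    define r where "r = component N i A - h \<star> x"
    have "r = 0"
    proof (rule ccontr)
      assume r: "r \<noteq> 0"
      define w where "w j = (if j = i then 1 else 0) - v j \<star> x" for j
      have "(\<Sum>j<N. component N j A \<star> w j)
          = (\<Sum>j<N. (if j = i then component N i A else 0)) - (\<Sum>j<N. component N j A \<star> v j) \<star> x"
        unfolding w_def skew_sum_left sum_subtractf[symmetric]
        by (intro sum.cong) (auto simp: skew_diff_right skew_assoc)
      also have "\<dots> = r" using i by (simp add: v(2) r_def)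
      finally have "(\<Sum>j<N. component N j A \<star> w j) = r" .
      moreover have "sparse N (w j)" for j
        by (simp add: w_def sparse_diff sparse_skew_mult v(1) x(1))
      moreover have "sparse N r"
        by (simp add: r_def sparse_diff sparse_skew_mult h0 x(1) sparse_component)
      ultimately have "r \<in> J" using r by (auto simp: J_def)
      then have "degree h \<le> degree r" by (rule h(2))
      moreover have "coeff r (degree r) \<noteq> 0" using r by simp
      ultimately show False using x(2)[of "degree r"] unfolding r_def by blast
    qed
    then show ?thesis by (auto simp: r_def)
  qed
  then obtain x where x: "\<And>i. i < N \<Longrightarrow> component N i A = h \<star> x i" by metis
  define A' where "A' = (\<Sum>i<N. x i \<star> monom 1 i)"
  have "A = (\<Sum>i<N. component N i A \<star> monom 1 i)" by (rule component_decomposition[OF assms(2)])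
  also have "\<dots> = h \<star> A'" unfolding A'_def skew_sum_right
    by (intro sum.cong) (simp_all add: x skew_assoc)
  finally have AA': "A = h \<star> A'" .
  then have A'0: "A' \<noteq> 0" using A(1) by (auto simp: good_def)
  have "good A'" using A(1) A'0 sparse_left_factor[OF assms(2) h0(2,1), of "A' \<star> P"]
    by (simp add: good_def AA' skew_assoc)
  then have "degree A \<le> degree A'" by (rule A(2))
  then have "degree h = 0" using AA' degree_skew_mult[OF h0(1) A'0] by simp
  then obtain g where "h = monom g 0" by (metis degree_0_id monom_0)
  with that[of A g v] A(1) v(2) h0 show ?thesis by (auto simp: good_def)
qed

end


section \<open>Weights of operators\<close>

lemma mult_less_of_le:
  fixes a b c d :: real
  assumes "0 \<le> a" "0 \<le> b" "a \<le> c" "b \<le> d" "0 < c" "0 < d" "a < c \<or> b < d"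
  shows "a * b < c * d"
proof (cases "a < c")
  case True
  have "a * b \<le> a * d" using assms by (intro mult_left_mono)
  also have "\<dots> < c * d" using True assms by simp
  finally show ?thesis .
next
  case False
  with assms show ?thesis by auto
qed

locale nonarchimedean_field =
  fixes av :: "'k::field \<Rightarrow> real"
  assumes av_zero [simp]: "av 0 = 0"
    and av_pos: "a \<noteq> 0 \<Longrightarrow> 0 < av a"
    and av_mult: "av (a * b) = av a * av b"
    and av_add: "av (a + b) \<le> max (av a) (av b)"
begin

lemma av_nonneg [simp]: "0 \<le> av a"
  by (cases "a = 0") (simp_all add: av_pos less_imp_le)

lemma av_one [simp]: "av 1 = 1"
  using av_mult[of 1 1] av_pos[of 1] by simp

lemma av_minus [simp]: "av (- a) = av a"
proof -
  have "av (- 1) * av (- 1) = 1" using av_mult[of "- 1" "- 1"] by simp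
  then have "(av (- 1))\<^sup>2 = 1" by (simp add: power2_eq_square)
  then have "av (- 1) = 1" using av_nonneg[of "- 1"] by (auto simp: power2_eq_1_iff)
  then show ?thesis using av_mult[of "- 1" a] by simp
qed

lemma av_sum_le:
  assumes "0 \<le> c" "\<And>x. x \<in> A \<Longrightarrow> av (g x) \<le> c"
  shows "av (sum g A) \<le> c"
  using assms(2)
proof (induction A rule: infinite_finite_induct)
  case (insert x A)
  then have "av (g x) \<le> c" "av (sum g A) \<le> c" by auto
  then show ?case using insert.hyps av_add[of "g x" "sum g A"] by simp
qed (simp_all add: assms(1))

lemma av_sum_less:
  assumes "0 < c" "\<And>x. x \<in> A \<Longrightarrow> av (g x) < c"
  shows "av (sum g A) < c"
  using assms(2)
proof (induction A rule: infinite_finite_induct)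
  case (insert x A)
  then have "av (g x) < c" "av (sum g A) < c" by auto
  then show ?case using insert.hyps av_add[of "g x" "sum g A"] by simp
qed (simp_all add: assms(1))

lemma av_add_dominant:
  assumes "av b < av a" shows "av (a + b) = av a"
  using assms av_add[of a b] av_add[of "a + b" "- b"] by auto

lemma av_sum_dominant:
  assumes "finite A" "x \<in> A" "g x \<noteq> 0" "\<And>y. y \<in> A \<Longrightarrow> y \<noteq> x \<Longrightarrow> av (g y) < av (g x)"
  shows "av (sum g A) = av (g x)"
proof -
  have "av (sum g (A - {x})) < av (g x)"
    using assms by (intro av_sum_less av_pos) auto
  then show ?thesis using assms(1,2) by (simp add: sum.remove av_add_dominant)
qed

end

locale valued_difference_field = difference_field \<sigma> + nonarchimedean_field av
  for \<sigma> :: "'k::field \<Rightarrow> 'k" and av :: "'k \<Rightarrow> real" +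
  fixes \<rho> :: real
  assumes av_hom: "av (\<sigma> a) = av a"
    and rho_pos: "0 < \<rho>"
begin

lemma av_pow [simp]: "av ((\<sigma> ^^ i) a) = av a"
  by (induction i) (simp_all add: av_hom)

text \<open>The norm of the term \<open>a L\<^sup>i\<close> if \<open>L\<close> is given the size \<open>\<rho>\<close>; for \<open>\<rho> = 2\<^sup>s\<close> and the absolute value
  \<open>2\<^bsup>deg a\<^esup>\<close> its logarithm is the linear form \<open>deg a + s i\<close> on the Newton polygon.\<close>
definition weight :: "'k poly \<Rightarrow> nat \<Rightarrow> real" where
  "weight p i = av (coeff p i) * \<rho> ^ i"

lemma weight_nonneg [simp]: "0 \<le> weight p i"
  using rho_pos by (simp add: weight_def)

lemma weight_pos_iff: "0 < weight p i \<longleftrightarrow> coeff p i \<noteq> 0"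
  using rho_pos av_pos[of "coeff p i"] by (auto simp: weight_def)

lemma weight_zero [simp]: "coeff p i = 0 \<Longrightarrow> weight p i = 0"
  by (simp add: weight_def)

lemma weight_minus [simp]: "weight (- p) i = weight p i"
  by (simp add: weight_def)

lemma weight_add: "weight (p + q) i \<le> max (weight p i) (weight q i)"
  using mult_right_mono[OF av_add, of "\<rho> ^ i" "coeff p i" "coeff q i"] rho_pos
  by (simp add: weight_def max_mult_distrib_right)

lemma weight_bounded: obtains c where "0 < c" "\<And>i. weight p i \<le> c"
proof
  show "0 < 1 + (\<Sum>i\<le>degree p. weight p i)" by (simp add: add_pos_nonneg sum_nonneg)
  show "weight p i \<le> 1 + (\<Sum>i\<le>degree p. weight p i)" for i
  proof (cases "i \<le> degree p")
    case True
    then have "weight p i \<le> (\<Sum>i\<le>degree p. weight p i)" by (intro member_le_sum) auto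
    then show ?thesis by simp
  next
    case False
    then show ?thesis by (simp add: coeff_eq_0 add_nonneg_nonneg sum_nonneg)
  qed
qed

lemma av_skew_term:
  assumes "i \<le> n"
  shows "av (coeff p i * (\<sigma> ^^ i) (coeff q (n - i))) * \<rho> ^ n = weight p i * weight q (n - i)"
proof -
  have "\<rho> ^ n = \<rho> ^ i * \<rho> ^ (n - i)" using assms by (simp add: power_add[symmetric])
  then show ?thesis by (simp add: av_mult weight_def)
qed

lemma weight_skew_mult_le:
  assumes "\<And>i. weight p i \<le> c" "\<And>i. weight q i \<le> d"
  shows "weight (p \<star> q) n \<le> c * d"
proof -
  have cd: "0 \<le> c" "0 \<le> d" using assms weight_nonneg order_trans by blast+
  have "av (coeff (p \<star> q) n) \<le> c * d / \<rho> ^ n"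
    unfolding coeff_skew_mult
  proof (rule av_sum_le)
    fix i assume "i \<in> {..n}"
    then have "av (coeff p i * (\<sigma> ^^ i) (coeff q (n - i))) * \<rho> ^ n = weight p i * weight q (n - i)"
      by (simp add: av_skew_term)
    also have "\<dots> \<le> c * d" using assms cd by (intro mult_mono) auto
    finally show "av (coeff p i * (\<sigma> ^^ i) (coeff q (n - i))) \<le> c * d / \<rho> ^ n"
      using rho_pos by (simp add: pos_le_divide_eq)
  qed (use cd rho_pos in simp)
  then show ?thesis using rho_pos by (simp add: weight_def pos_le_divide_eq)
qed

text \<open>If one pair of terms strictly outweighs all other pairs that contribute to the same power of \<open>L\<close>,
  there is no cancellation against it.\<close>
lemma weight_skew_mult_extremal:
  assumes "coeff p i \<noteq> 0" "coeff q j \<noteq> 0"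
    and "\<And>l. l \<le> i + j \<Longrightarrow> l \<noteq> i \<Longrightarrow> weight p l * weight q (i + j - l) < weight p i * weight q j"
  shows "weight (p \<star> q) (i + j) = weight p i * weight q j"
proof -
  define t where "t l = coeff p l * (\<sigma> ^^ l) (coeff q (i + j - l))" for l
  have t: "av (t l) * \<rho> ^ (i + j) = weight p l * weight q (i + j - l)" if "l \<le> i + j" for l
    using av_skew_term[OF that] by (simp add: t_def)
  have "av (sum t {..i + j}) = av (t i)"
  proof (rule av_sum_dominant)
    fix l assume l: "l \<in> {..i + j}" "l \<noteq> i"
    then have "av (t l) * \<rho> ^ (i + j) < av (t i) * \<rho> ^ (i + j)"
      using assms(3)[of l] t[of l] t[of i] by simp
    then show "av (t l) < av (t i)" using rho_pos by simp
  qed (use assms in \<open>auto simp: t_def\<close>)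
  then have "weight (p \<star> q) (i + j) = av (t i) * \<rho> ^ (i + j)"
    unfolding weight_def coeff_skew_mult t_def by simp
  with t[of i] show ?thesis by simp
qed

definition dominant :: "'k poly \<Rightarrow> nat \<Rightarrow> bool" where
  "dominant p c \<longleftrightarrow> coeff p c \<noteq> 0 \<and> (\<forall>i. i \<noteq> c \<longrightarrow> weight p i < weight p c)"

lemma dominant_gap:
  assumes "dominant p c"
  obtains \<theta> where "0 \<le> \<theta>" "\<theta> < 1" "\<And>i. i \<noteq> c \<Longrightarrow> weight p i \<le> \<theta> * weight p c"
proof -
  define S where "S = insert 0 (weight p ` ({..degree p} - {c}))"
  have S: "finite S" "S \<noteq> {}" by (simp_all add: S_def)
  have pos: "0 < weight p c" using assms by (simp add: dominant_def weight_pos_iff)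
  have "Max S < weight p c"
    using assms pos S by (auto simp: Max_less_iff S_def dominant_def)
  moreover have "weight p i \<le> Max S" if "i \<noteq> c" for i
    using that by (cases "i \<le> degree p") (auto intro!: Max_ge S simp: S_def coeff_eq_0)
  moreover have "0 \<le> Max S" by (intro Max_ge S) (simp add: S_def)
  ultimately show ?thesis using pos that[of "Max S / weight p c"] by simp
qed

text \<open>The two ends of the set of indices of maximal weight: at the sum of two such ends only one pair of
  terms of a product has the maximal weight.\<close>
lemma max_weight_extremes:
  assumes "p \<noteq> 0"
  obtains i1 i2 where "i1 \<le> i2" "weight p i1 = weight p i2" "0 < weight p i1" "\<And>i. weight p i \<le> weight p i1"
    "\<And>i. i < i1 \<Longrightarrow> weight p i < weight p i1" "\<And>i. i2 < i \<Longrightarrow> weight p i < weight p i1"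
proof -
  define m where "m = Max (weight p ` {..degree p})"
  have fin: "finite (weight p ` {..degree p})" "weight p ` {..degree p} \<noteq> {}" by auto
  have m_pos: "0 < m"
  proof -
    have "0 < weight p (degree p)" using assms by (simp add: weight_pos_iff)
    also have "\<dots> \<le> m" unfolding m_def by (intro Max_ge fin) simp
    finally show ?thesis .
  qed
  have le: "weight p i \<le> m" for i
  proof (cases "i \<le> degree p")
    case True
    then show ?thesis unfolding m_def by (intro Max_ge fin) simp
  next
    case False
    with m_pos show ?thesis by (simp add: coeff_eq_0)
  qed
  define S where "S = {i. weight p i = m}"
  have "m \<in> weight p ` {..degree p}" unfolding m_def by (rule Max_in[OF fin])
  then have "S \<noteq> {}" by (auto simp: S_def)
  moreover have "S \<subseteq> {..degree p}"
  proof
    fix i assume "i \<in> S"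
    with m_pos have "coeff p i \<noteq> 0" using weight_pos_iff[of p i] by (simp add: S_def)
    then show "i \<in> {..degree p}" by (simp add: le_degree)
  qed
  then have "finite S" using finite_subset by blast
  ultimately have S: "Min S \<in> S" "Max S \<in> S" "\<And>i. i \<in> S \<Longrightarrow> Min S \<le> i" "\<And>i. i \<in> S \<Longrightarrow> i \<le> Max S"
    by simp_all
  have "weight p i < m" if "i \<notin> S" for i using le[of i] that by (simp add: S_def)
  moreover have "i \<notin> S" if "i < Min S \<or> Max S < i" for i using S(3,4)[of i] that by linarith
  ultimately have "weight p i < m" if "i < Min S \<or> Max S < i" for i using that by blast
  moreover have "weight p (Min S) = m" "weight p (Max S) = m" using S(1,2) by (simp_all add: S_def)
  moreover have "Min S \<le> Max S" using S(2,3) by blast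
  ultimately show ?thesis using that[of "Min S" "Max S"] m_pos le by simp
qed

text \<open>As in Gauss's lemma, the first indices of maximal weight of the two factors add up to an index of
  maximal weight of the product, and so do the last ones. If the product has only one such index,
  then so has each factor.\<close>
lemma dominant_left_factor:
  assumes "dominant (q \<star> z) k" obtains c where "dominant q c"
proof -
  have "q \<star> z \<noteq> 0" using assms by (auto simp: dominant_def)
  then have qz: "q \<noteq> 0" "z \<noteq> 0" by auto
  obtain i1 i2 where i: "i1 \<le> i2" "weight q i1 = weight q i2" "0 < weight q i1" "\<And>i. weight q i \<le> weight q i1"
    "\<And>i. i < i1 \<Longrightarrow> weight q i < weight q i1" "\<And>i. i2 < i \<Longrightarrow> weight q i < weight q i1"
    using max_weight_extremes[OF qz(1)] by metis
  obtain j1 j2 where j: "j1 \<le> j2" "weight z j1 = weight z j2" "0 < weight z j1" "\<And>i. weight z i \<le> weight z j1"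
    "\<And>i. i < j1 \<Longrightarrow> weight z i < weight z j1" "\<And>i. j2 < i \<Longrightarrow> weight z i < weight z j1"
    using max_weight_extremes[OF qz(2)] by metis
  have "weight (q \<star> z) (i1 + j1) = weight q i1 * weight z j1"
  proof (rule weight_skew_mult_extremal)
    fix l assume "l \<le> i1 + j1" "l \<noteq> i1"
    then have "l < i1 \<or> i1 + j1 - l < j1" by linarith
    with i j show "weight q l * weight z (i1 + j1 - l) < weight q i1 * weight z j1"
      by (intro mult_less_of_le) auto
  qed (use i j in \<open>auto simp: weight_pos_iff[symmetric]\<close>)
  moreover have "weight (q \<star> z) (i2 + j2) = weight q i2 * weight z j2"
  proof (rule weight_skew_mult_extremal)
    fix l assume "l \<le> i2 + j2" "l \<noteq> i2"
    then have "i2 < l \<or> j2 < i2 + j2 - l" by linarith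
    with i j show "weight q l * weight z (i2 + j2 - l) < weight q i2 * weight z j2"
      by (intro mult_less_of_le) auto
  qed (use i j in \<open>auto simp: weight_pos_iff[symmetric]\<close>)
  moreover have "weight (q \<star> z) k \<le> weight q i1 * weight z j1"
    using i(4) j(4) by (rule weight_skew_mult_le)
  ultimately have "\<not> weight (q \<star> z) (i1 + j1) < weight (q \<star> z) k" "\<not> weight (q \<star> z) (i2 + j2) < weight (q \<star> z) k"
    using i(2) j(2) by simp_all
  then have "i1 + j1 = k" "i2 + j2 = k" using assms by (auto simp: dominant_def)
  with i(1) j(1) have "i2 = i1" by linarith
  with i have "weight q l < weight q i1" if "l \<noteq> i1" for l using that by (cases l i1 rule: linorder_cases) auto
  with i(3) have "dominant q i1" by (simp add: dominant_def weight_pos_iff)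
  then show ?thesis by (rule that)
qed

text \<open>Dividing \<open>E\<close> by the dominant term of \<open>P\<close> alone leaves a remainder lighter by the factor \<open>\<theta>\<close>; this is
  repeated \<open>T\<close> times. Each step lowers the exponents of \<open>L\<close> by up to \<open>c\<close>, whence the condition on \<open>E\<close>.\<close>
lemma approximate_right_division:
  assumes P: "coeff P c \<noteq> 0" "\<And>i. i \<noteq> c \<Longrightarrow> weight P i \<le> \<theta> * weight P c" and \<theta>: "0 \<le> \<theta>"
    and E: "\<And>i. i < c * T \<Longrightarrow> coeff E i = 0" "\<And>i. weight E i \<le> e"
  shows "\<exists>Y. \<forall>i. weight (E - P \<star> Y) i \<le> \<theta> ^ T * e"
  using E
proof (induction T arbitrary: E e)
  case 0
  then show ?case by (intro exI[of _ 0]) simp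
next
  case (Suc T)
  define \<mu> where "\<mu> = weight P c"
  have \<mu>: "0 < \<mu>" using P by (simp add: \<mu>_def weight_pos_iff)
  have e: "0 \<le> e" using Suc.prems(2) weight_nonneg order_trans by blast
  define s where "s = inv (\<sigma> ^^ c)"
  have s: "(\<sigma> ^^ c) (s b) = b" for b
    unfolding s_def by (metis f_inv_into_f pow_surj rangeI)
  have s0: "s 0 = 0" using s[of 0] by simp
  define Y where "Y = Abs_poly (\<lambda>j. s (coeff E (j + c) / coeff P c))"
  have coeff_Y: "coeff Y j = s (coeff E (j + c) / coeff P c)" for j
  proof -
    have "\<forall>\<^sub>\<infinity>j. s (coeff E (j + c) / coeff P c) = 0"
      unfolding MOST_nat by (intro exI[of _ "degree E"]) (simp add: coeff_eq_0 s0)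
    then show ?thesis by (simp add: Y_def Abs_poly_inverse)
  qed
  have lead: "monom (coeff P c) c \<star> Y = E"
  proof (rule poly_eqI)
    fix n
    have "coeff E n = 0" if "n < c" using Suc.prems(1)[of n] that by simp
    then show "coeff (monom (coeff P c) c \<star> Y) n = coeff E n"
      using P(1) by (simp add: coeff_monom_skew coeff_Y s)
  qed
  have weight_Y: "weight Y j \<le> e / \<mu>" for j
  proof -
    have "av (coeff Y j) = av (coeff E (j + c) / coeff P c)"
      using av_pow[of c "coeff Y j"] by (simp add: coeff_Y s)
    moreover have "av (coeff E (j + c) / coeff P c) * av (coeff P c) = av (coeff E (j + c))"
      using P(1) by (simp add: av_mult[symmetric])
    ultimately have "weight Y j * \<mu> = weight E (j + c)"
      by (simp add: weight_def \<mu>_def power_add ac_simps)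
    with Suc.prems(2)[of "j + c"] \<mu> show ?thesis by (simp add: pos_le_divide_eq)
  qed
  define p where "p = P - monom (coeff P c) c"
  have "E - P \<star> Y = - (p \<star> Y)"
    using lead by (simp add: p_def skew_diff_left)
  moreover have "weight p i \<le> \<theta> * \<mu>" for i
    using P(2)[of i] \<theta> \<mu> by (cases "i = c") (simp_all add: p_def weight_def \<mu>_def)
  then have "weight (p \<star> Y) n \<le> \<theta> * \<mu> * (e / \<mu>)" for n
    using weight_Y by (rule weight_skew_mult_le)
  ultimately have wtE: "weight (E - P \<star> Y) n \<le> \<theta> * e" for n
    using \<mu> by simp
  have "coeff Y j = 0" if "j < c * T" for j
    using Suc.prems(1)[of "j + c"] that by (simp add: coeff_Y s0)
  then have "coeff (E - P \<star> Y) n = 0" if "n < c * T" for n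
    using that Suc.prems(1)[of n] by (simp add: coeff_skew_mult)
  from Suc.IH[OF this wtE] obtain Z where "\<forall>i. weight (E - P \<star> Y - P \<star> Z) i \<le> \<theta> ^ T * (\<theta> * e)"
    by blast
  then show ?case
    by (intro exI[of _ "Y + Z"]) (simp add: skew_add_right diff_diff_eq ac_simps)
qed

text \<open>Moves \<open>L\<^sup>k\<close> from the right of \<open>v\<close> to the left, by applying \<open>\<sigma>\<^bsup>-k\<^esup>\<close> to the coefficients.\<close>
lemma monom_skew_commute:
  obtains w where "monom 1 k \<star> w = v \<star> monom 1 k" "\<And>i. weight w i = weight v i"
proof -
  define s where "s = inv (\<sigma> ^^ k)"
  have s: "(\<sigma> ^^ k) (s b) = b" for b
    unfolding s_def by (metis f_inv_into_f pow_surj rangeI)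
  have s0: "s 0 = 0" using s[of 0] by simp
  have "av (s b) = av b" for b using av_pow[of k "s b"] by (simp add: s)
  then have "weight (map_poly s v) i = weight v i" for i
    by (simp add: weight_def coeff_map_poly s0)
  moreover have "monom 1 k \<star> map_poly s v = v \<star> monom 1 k"
    by (rule poly_eqI) (simp add: coeff_monom_skew coeff_skew_monom coeff_map_poly s0 s)
  ultimately show ?thesis by (rule that[rotated])
qed

lemma weight_component_le:
  assumes "\<And>n. weight p n \<le> c" shows "weight (component N i p) n \<le> c / \<rho> ^ i"
proof (cases "N dvd n")
  case True
  have "weight p (n + i) \<le> c" by (rule assms)
  then have "av (coeff p (n + i)) * \<rho> ^ n * \<rho> ^ i \<le> c" by (simp add: weight_def power_add ac_simps)
  with True rho_pos show ?thesis by (simp add: weight_def coeff_component pos_le_divide_eq)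
next
  case False
  moreover have "0 \<le> c" using assms weight_nonneg order_trans by blast
  ultimately show ?thesis using rho_pos by (simp add: weight_def coeff_component)
qed

lemma weight_sum_le:
  assumes "0 \<le> c" "\<And>x. x \<in> A \<Longrightarrow> weight (g x) n \<le> c"
  shows "weight (sum g A) n \<le> c"
  using assms(2)
proof (induction A rule: infinite_finite_induct)
  case (insert x A)
  then have "weight (g x) n \<le> c" "weight (sum g A) n \<le> c" by auto
  then show ?case using insert.hyps weight_add[of "g x" "sum g A" n] by simp
qed (simp_all add: assms(1))

lemma component_skew_monom:
  assumes "N dvd k" "i < N"
  shows "component N i (p \<star> monom 1 k) = component N i p \<star> monom 1 k"
proof (rule poly_eqI)
  fix n
  show "coeff (component N i (p \<star> monom 1 k)) n = coeff (component N i p \<star> monom 1 k) n"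
  proof (cases "k \<le> n")
    case True
    with assms(1) have "N dvd n - k \<longleftrightarrow> N dvd n" by (metis dvd_diffD dvd_diff_nat)
    with True show ?thesis by (simp add: coeff_component coeff_skew_monom)
  next
    case False
    have "n + i < k" if "N dvd n"
    proof -
      from that assms(1) have "N dvd k - n" by simp
      with False have "N \<le> k - n" by (intro dvd_imp_le) auto
      with assms(2) show ?thesis by linarith
    qed
    with False show ?thesis by (auto simp: coeff_component coeff_skew_monom)
  qed
qed

text \<open>The quotient \<open>Y\<close> of \<open>L\<^sup>k\<close> by \<open>P\<close> satisfies \<open>(A P) Y = A L\<^sup>k - A E\<close>. Its components, weighted by the
  coefficients of the relation \<open>\<Sum>\<^sub>i A\<^sub>i v\<^sub>i = g\<close>, add up to \<open>(A P) z = g L\<^sup>k - F\<close>, where the bound on \<open>F\<close> is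
  that on \<open>E\<close> times a constant that depends on \<open>A\<close> and the \<open>v\<^sub>i\<close> only. So \<open>E\<close> can be chosen light enough
  for \<open>g L\<^sup>k\<close> to dominate, and dominance passes to the left factor \<open>A P\<close>.\<close>
theorem dominant_sparse_multiple:
  assumes dom: "dominant P c" and N: "N > 0"
  obtains A k where "sparse N (A \<star> P)" "dominant (A \<star> P) k"
proof -
  have Pc: "coeff P c \<noteq> 0" using dom by (simp add: dominant_def)
  then have "P \<noteq> 0" by auto
  then obtain A v g where A: "A \<noteq> 0" "sparse N (A \<star> P)" and g: "g \<noteq> 0"
    and bezout: "(\<Sum>i<N. component N i A \<star> v i) = monom g 0"
    using primitive_cofactor_exists[OF _ N] by metis
  obtain \<theta> where \<theta>: "0 \<le> \<theta>" "\<theta> < 1" "\<And>i. i \<noteq> c \<Longrightarrow> weight P i \<le> \<theta> * weight P c"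
    using dominant_gap[OF dom] by metis
  obtain a where a: "0 < a" "\<And>i. weight A i \<le> a" using weight_bounded[of A] by metis
  have "\<exists>b>0. \<forall>n. weight (v i) n \<le> b" for i using weight_bounded[of "v i"] by metis
  then obtain b where b: "\<And>i. 0 < b i" "\<And>i n. weight (v i) n \<le> b i" by metis
  define B where "B = (\<Sum>i<N. b i / \<rho> ^ i)"
  have B: "b i / \<rho> ^ i \<le> B" if "i < N" for i
    unfolding B_def using that b(1) rho_pos by (intro member_le_sum) (auto intro: less_imp_le)
  have B_pos: "0 < B" unfolding B_def using b(1) rho_pos N by (intro sum_pos) auto
  obtain T where T: "\<theta> ^ T < av g / (a * B)"
    using real_arch_pow_inv[OF _ \<theta>(2)] av_pos[OF g] a(1) B_pos by (metis divide_pos_pos mult_pos_pos)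
  \<comment> \<open>A multiple of \<open>N\<close>, so that \<open>L\<^sup>k\<close> respects components, and at least \<open>c * T\<close>, which leaves room
    for \<open>T\<close> division steps.\<close>
  define k where "k = N * (c * T)"
  have "\<exists>Y. \<forall>i. weight (monom 1 k - P \<star> Y) i \<le> \<theta> ^ T * \<rho> ^ k"
  proof (rule approximate_right_division[OF Pc \<theta>(3,1)])
    show "coeff (monom 1 k) i = 0" if "i < c * T" for i
    proof -
      have "c * T \<le> k" using N by (simp add: k_def)
      with that show ?thesis by simp
    qed
    show "weight (monom 1 k) i \<le> \<rho> ^ k" for i using rho_pos by (simp add: weight_def)
  qed
  then obtain Y where Y: "\<And>i. weight (monom 1 k - P \<star> Y) i \<le> \<theta> ^ T * \<rho> ^ k" by blast
  define E where "E = monom 1 k - P \<star> Y"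
  have "\<exists>w. monom 1 k \<star> w = v i \<star> monom 1 k \<and> (\<forall>n. weight w n = weight (v i) n)" for i
    using monom_skew_commute by metis
  then obtain w where w: "\<And>i. monom 1 k \<star> w i = v i \<star> monom 1 k" "\<And>i n. weight (w i) n = weight (v i) n"
    by metis
  define z where "z = (\<Sum>i<N. component N i Y \<star> w i)"
  define F where "F = (\<Sum>i<N. component N i (A \<star> E) \<star> w i)"
  have "A \<star> P \<star> Y + A \<star> E = A \<star> monom 1 k"
    by (simp add: E_def skew_diff_right skew_assoc)
  moreover have "component N i (A \<star> monom 1 k) = component N i A \<star> monom 1 k" if "i < N" for i
    using that by (intro component_skew_monom) (simp_all add: k_def)
  ultimately have AY: "component N i (A \<star> P \<star> Y) + component N i (A \<star> E) = component N i A \<star> monom 1 k"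
    if "i < N" for i using that by (metis component_add)
  have "A \<star> P \<star> z + F = (\<Sum>i<N. (component N i (A \<star> P \<star> Y) + component N i (A \<star> E)) \<star> w i)"
  proof -
    have "A \<star> P \<star> z = (\<Sum>i<N. component N i (A \<star> P \<star> Y) \<star> w i)"
      unfolding z_def skew_sum_right
      by (intro sum.cong) (simp_all add: component_skew_mult[OF A(2)] skew_assoc[of "A \<star> P"])
    then show ?thesis by (simp add: F_def skew_add_left sum.distrib)
  qed
  also have "\<dots> = (\<Sum>i<N. component N i A \<star> v i \<star> monom 1 k)"
    by (intro sum.cong refl) (metis AY lessThan_iff skew_assoc w(1))
  also have "\<dots> = monom g k"
    by (simp add: skew_sum_left[symmetric] bezout poly_eq_iff coeff_monom_skew)
  finally have Qz: "A \<star> P \<star> z = monom g k - F" by (simp add: algebra_simps)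
  have "weight F n \<le> a * (\<theta> ^ T * \<rho> ^ k) * B" for n
    unfolding F_def
  proof (rule weight_sum_le)
    fix i assume "i \<in> {..<N}"
    then have i: "i < N" by simp
    have "weight (A \<star> E) l \<le> a * (\<theta> ^ T * \<rho> ^ k)" for l
      using a(2) Y unfolding E_def by (rule weight_skew_mult_le)
    then have "weight (component N i (A \<star> E)) l \<le> a * (\<theta> ^ T * \<rho> ^ k) / \<rho> ^ i" for l
      by (rule weight_component_le)
    moreover have "weight (w i) l \<le> b i" for l by (simp add: w(2) b(2))
    ultimately have "weight (component N i (A \<star> E) \<star> w i) n \<le> a * (\<theta> ^ T * \<rho> ^ k) / \<rho> ^ i * b i"
      by (rule weight_skew_mult_le)
    also have "\<dots> = a * (\<theta> ^ T * \<rho> ^ k) * (b i / \<rho> ^ i)" by simp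
    also have "\<dots> \<le> a * (\<theta> ^ T * \<rho> ^ k) * B"
      using B[OF i] a(1) \<theta>(1) rho_pos by (intro mult_left_mono) auto
    finally show "weight (component N i (A \<star> E) \<star> w i) n \<le> a * (\<theta> ^ T * \<rho> ^ k) * B" .
  qed (use a(1) \<theta>(1) rho_pos B_pos in auto)
  moreover have "a * (\<theta> ^ T * \<rho> ^ k) * B < av g * \<rho> ^ k"
  proof -
    have "\<theta> ^ T * (a * B) < av g" using T a(1) B_pos by (simp add: pos_less_divide_eq)
    then have "\<theta> ^ T * (a * B) * \<rho> ^ k < av g * \<rho> ^ k" using rho_pos by simp
    then show ?thesis by (simp add: ac_simps)
  qed
  ultimately have F: "weight F n < av g * \<rho> ^ k" for n by (rule le_less_trans)
  have weight_k: "weight (monom g k - F) k = av g * \<rho> ^ k"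
  proof -
    have "av (coeff F k) < av g" using F[of k] rho_pos by (simp add: weight_def)
    then show ?thesis using av_add_dominant[of "- coeff F k" g] by (simp add: weight_def)
  qed
  have "weight (monom g k - F) n < weight (monom g k - F) k" if "n \<noteq> k" for n
    unfolding weight_k using F[of n] that by (simp add: weight_def)
  moreover have "coeff (monom g k - F) k \<noteq> 0"
    unfolding weight_pos_iff[symmetric] weight_k using av_pos[OF g] rho_pos by simp
  ultimately have "dominant (A \<star> P \<star> z) k" unfolding Qz by (simp add: dominant_def)
  then obtain l where "dominant (A \<star> P) l" by (rule dominant_left_factor)
  with A(2) show ?thesis by (rule that)
qed

end


section \<open>The degree on a field of rational functions\<close>

text \<open>Used both for the degree in \<open>M\<close> on \<open>\<rat>(M,q)\<close> and for the degree in \<open>q\<close> on \<open>\<rat>(q)\<close>.\<close>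
definition fract_degree :: "'a::idom poly fract \<Rightarrow> int" where
  "fract_degree x = (THE d. \<exists>a b. a \<noteq> 0 \<and> b \<noteq> 0 \<and> x = Fract a b \<and> d = int (degree a) - int (degree b))"

lemma fract_degree_Fract:
  assumes "a \<noteq> 0" "b \<noteq> 0"
  shows "fract_degree (Fract a b) = int (degree a) - int (degree b)"
  unfolding fract_degree_def
proof (rule the_equality)
  fix d
  assume "\<exists>a' b'. a' \<noteq> 0 \<and> b' \<noteq> 0 \<and> Fract a b = Fract a' b' \<and> d = int (degree a') - int (degree b')"
  then obtain a' b' where *: "a' \<noteq> 0" "b' \<noteq> 0" "Fract a b = Fract a' b'"
    "d = int (degree a') - int (degree b')" by blast
  then have "a * b' = a' * b" using assms by (simp add: eq_fract)
  then have "degree a + degree b' = degree a' + degree b"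
    using * assms by (metis degree_mult_eq)
  with * show "d = int (degree a) - int (degree b)" by linarith
qed (use assms in blast)

lemma fract_nonzeroE:
  fixes x :: "'a::idom fract"
  assumes "x \<noteq> 0" obtains a b where "x = Fract a b" "a \<noteq> 0" "b \<noteq> 0"
proof (cases x)
  case (Fract a b)
  with assms that[of a b] show ?thesis by (cases "a = 0") (auto simp: rat_number_collapse eq_fract fract_collapse)
qed

definition degree_abs :: "'a::idom poly fract \<Rightarrow> real" where
  "degree_abs x = (if x = 0 then 0 else 2 powr real_of_int (fract_degree x))"

lemma degree_abs_add_le: "degree_abs (x + y) \<le> max (degree_abs x) (degree_abs y)"
proof (cases "x = 0 \<or> y = 0 \<or> x + y = 0")
  case True
  then show ?thesis by (auto simp: degree_abs_def max_def)
next
  case False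
  then obtain a b where x: "x = Fract a b" "a \<noteq> 0" "b \<noteq> 0" using fract_nonzeroE by metis
  from False obtain c d where y: "y = Fract c d" "c \<noteq> 0" "d \<noteq> 0" using fract_nonzeroE by metis
  have xy: "x + y = Fract (a * d + c * b) (b * d)" using x y by simp
  with False x y have nz: "a * d + c * b \<noteq> 0" by (auto simp: fract_collapse)
  have "degree (a * d + c * b) \<le> max (degree (a * d)) (degree (c * b))"
    by (rule degree_add_le_max)
  then have "fract_degree (x + y) \<le> max (fract_degree x) (fract_degree y)"
    unfolding xy using x y nz by (simp add: fract_degree_Fract degree_mult_eq max_def split: if_splits)
  then show ?thesis using False by (auto simp: degree_abs_def max_def split: if_splits)
qed

lemma fract_degree_mult:
  assumes "x \<noteq> 0" "y \<noteq> 0" shows "fract_degree (x * y) = fract_degree x + fract_degree y"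
proof -
  obtain a b where x: "x = Fract a b" "a \<noteq> 0" "b \<noteq> 0" using assms fract_nonzeroE by metis
  obtain c d where y: "y = Fract c d" "c \<noteq> 0" "d \<noteq> 0" using assms fract_nonzeroE by metis
  show ?thesis using x y by (simp add: fract_degree_Fract degree_mult_eq)
qed

interpretation degree_abs: nonarchimedean_field "degree_abs :: 'a::idom poly fract \<Rightarrow> real"
proof
  show "degree_abs (a * b) = degree_abs a * degree_abs b" for a b :: "'a poly fract"
    by (simp add: degree_abs_def fract_degree_mult powr_add)
qed (simp_all add: degree_abs_def[where x = 0] degree_abs_add_le, simp add: degree_abs_def)

lemma deg_q_eq_fract_degree:
  assumes "x \<noteq> 0" shows "deg_q x = fract_degree x"
  using assms by (elim fract_nonzeroE) (simp add: deg_q_Fract fract_degree_Fract)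

section \<open>The operators over \<open>\<rat>(M,q)\<close>\<close>

lemma qshift_ZMq_simps:
  "qshift_ZMq (a + b) = qshift_ZMq a + qshift_ZMq b"
  "qshift_ZMq (a * b) = qshift_ZMq a * qshift_ZMq b"
  "qshift_ZMq a = 0 \<longleftrightarrow> a = 0"
  "degree (qshift_ZMq a) = degree a"
  "coeff (qshift_ZMq a) i = [:0, 1:] ^ i * coeff a i"
  by (simp_all add: qshift_ZMq_def pcompose_add pcompose_mult pcompose_eq_0_iff degree_pcompose
      coeff_pcompose_linear)

interpretation qshift: difference_field qshift
proof
  fix a b :: QMq
  obtain u v where a: "a = Fract u v" "v \<noteq> 0" by (cases a) auto
  obtain u' v' where b: "b = Fract u' v'" "v' \<noteq> 0" by (cases b) auto
  show "qshift (a + b) = qshift a + qshift b"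
    using a b by (simp add: qshift_Fract qshift_ZMq_simps)
  show "qshift (a * b) = qshift a * qshift b"
    using a b by (simp add: qshift_Fract qshift_ZMq_simps)
next
  have "qshift (Fract 1 1) = Fract 1 1"
    by (subst qshift_Fract) (simp_all add: qshift_ZMq_def pcompose_1)
  then show "qshift 1 = 1" by (simp add: One_fract_def)
next
  \<comment> \<open>A preimage of \<open>u(M,q)\<close> is \<open>u(q\<^bsup>-1\<^esup>M, q)\<close>; in a fraction the common factor \<open>q\<^sup>D\<close> makes it integral.\<close>
  have "\<exists>b. qshift b = a" for a
  proof -
    obtain u v where a: "a = Fract u v" "v \<noteq> 0" by (cases a) auto
    define D where "D = max (degree u) (degree v)"
    define x :: Zq where "x = [:0, 1:]"
    have "\<exists>t. qshift_ZMq t = smult (x ^ D) w" if "degree w \<le> D" for w :: ZMq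
    proof -
      define t where "t = (\<Sum>i\<le>D. monom (x ^ (D - i) * coeff w i) i)"
      have "coeff (qshift_ZMq t) i = coeff (smult (x ^ D) w) i" for i
      proof (cases "i \<le> D")
        case True
        then have "x ^ i * x ^ (D - i) = x ^ D" by (simp add: power_add[symmetric])
        with True show ?thesis
          by (simp add: qshift_ZMq_simps t_def coeff_sum x_def[symmetric] mult.assoc[symmetric])
      next
        case False
        with that show ?thesis by (simp add: qshift_ZMq_simps t_def coeff_sum coeff_eq_0)
      qed
      then show ?thesis by (auto simp: poly_eq_iff)
    qed
    then obtain s t where st: "qshift_ZMq s = smult (x ^ D) u" "qshift_ZMq t = smult (x ^ D) v"
      by (metis D_def max.cobounded1 max.cobounded2)
    have xD: "x ^ D \<noteq> 0" by (simp add: x_def)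
    then have "t \<noteq> 0" using st(2) a(2) qshift_ZMq_simps(3)[of t] by auto
    then have "qshift (Fract s t) = Fract (smult (x ^ D) u) (smult (x ^ D) v)"
      using st by (simp add: qshift_Fract)
    also have "\<dots> = a" using a xD by (simp add: eq_fract)
    finally show ?thesis by blast
  qed
  then show "surj qshift" by (metis surjI)
qed

lemma fract_degree_qshift: "a \<noteq> 0 \<Longrightarrow> fract_degree (qshift a) = fract_degree a"
  by (elim fract_nonzeroE) (simp add: qshift_Fract fract_degree_Fract qshift_ZMq_simps)

lemma degree_abs_qshift: "degree_abs (qshift a) = degree_abs a"
  using qshift.pow_eq_0_iff[of 1 a] qshift.pow_zero[of 1] by (auto simp: degree_abs_def fract_degree_qshift)

lemma valued_qshift: "0 < \<rho> \<Longrightarrow> valued_difference_field qshift degree_abs \<rho>"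
  by unfold_locales (simp_all add: degree_abs_qshift)

lemma wloc_mult_eq_skew_mult: "wloc_mult = qshift.skew_mult"
  by (intro ext) (simp add: wloc_mult_def qshift.skew_mult_def)

section \<open>Degrees along an arithmetic progression\<close>

lemma eval_ZMq_eq: "eval_ZMq n a = to_fract (poly a (monom 1 n))"
proof (induction a)
  case (pCons c a)
  have "qvar ^ n = to_fract (monom 1 n)"
    by (induction n) (simp_all add: qvar_def monom_Suc flip: to_fract_mult)
  with pCons show ?case by (simp add: eval_ZMq_def map_poly_pCons)
qed (simp add: eval_ZMq_def)

text \<open>For large \<open>n\<close> the powers of \<open>q\<^sup>n\<close> separate the coefficients, so the leading term wins.\<close>
lemma degree_eval_monom:
  fixes a :: "'a::idom poly poly"
  assumes "a \<noteq> 0"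
  shows "\<forall>\<^sub>F n in sequentially. poly a (monom 1 n) \<noteq> 0 \<and>
    degree (poly a (monom 1 n)) = n * degree a + degree (lead_coeff a)"
  using assms
proof (induction a)
  case (pCons c a)
  show ?case
  proof (cases "a = 0")
    case True
    with pCons.hyps show ?thesis by simp
  next
    case False
    from pCons.IH[OF False] eventually_gt_at_top[of "degree c"]
    show ?thesis
    proof eventually_elim
      case (elim n)
      have *: "degree (monom 1 n * poly a (monom 1 n)) = n + (n * degree a + degree (lead_coeff a))"
        using elim by (simp add: degree_mult_eq degree_monom_eq)
      with elim have "degree c < degree (monom 1 n * poly a (monom 1 n))" by simp
      then have "degree (poly (pCons c a) (monom 1 n)) = degree (monom 1 n * poly a (monom 1 n))"
        by (simp add: degree_add_eq_right)
      with * elim False show ?case by (auto simp: degree_0)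
    qed
  qed
qed simp

lemma deg_q_eval_QMq:
  assumes "a \<noteq> 0"
  obtains e where "\<forall>\<^sub>F n in sequentially. eval_QMq n a \<noteq> 0 \<and>
    fract_degree (eval_QMq n a) = int n * fract_degree a + e"
proof -
  obtain u v where a: "a = Fract u v" "u \<noteq> 0" "v \<noteq> 0" using assms by (rule fract_nonzeroE)
  from degree_eval_monom[OF a(2)] degree_eval_monom[OF a(3)]
  have "\<forall>\<^sub>F n in sequentially. eval_QMq n a \<noteq> 0 \<and> fract_degree (eval_QMq n a)
    = int n * fract_degree a + (int (degree (lead_coeff u)) - int (degree (lead_coeff v)))"
  proof eventually_elim
    case (elim n)
    then have "eval_QMq n a = Fract (poly u (monom 1 n)) (poly v (monom 1 n))"
      unfolding a(1) by (subst eval_QMq_Fract; simp add: eval_ZMq_eq) (simp add: to_fract_def)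
    with elim a show ?case by (simp add: fract_degree_Fract algebra_simps Zero_fract_def eq_fract)
  qed
  then show ?thesis by (rule that)
qed

lemma eventually_progression:
  assumes "\<forall>\<^sub>F n in sequentially. Q n" "(0::nat) < N"
  shows "\<forall>\<^sub>F m in sequentially. Q (r + N * m)"
proof -
  from assms(1) obtain K where K: "\<And>n. K \<le> n \<Longrightarrow> Q n" by (auto simp: eventually_sequentially)
  have "m \<le> r + N * m" for m using assms(2) by (simp add: trans_le_add2)
  then have "Q (r + N * m)" if "K \<le> m" for m using K that order_trans by blast
  then show ?thesis by (auto simp: eventually_sequentially)
qed

text \<open>Only members \<open>f (n + j)\<close> with \<open>N dvd j\<close> occur in \<open>Q f\<close>, so for \<open>n\<close> in the class of \<open>r\<close> all their degrees
  come from one quadratic polynomial, with the coefficient \<open>s = g2 r\<close> at \<open>n choose 2\<close>. The summand at \<open>j\<close> has degree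
  \<open>base n + n \<alpha>\<^sub>j + O(1)\<close> where \<open>\<alpha>\<^sub>j\<close> is the logarithm of the weight of the term at \<open>j\<close> of \<open>Q\<close>. By dominance
  a single summand has the largest degree for large \<open>n\<close>, and the sum does not vanish.\<close>
lemma sparse_dominant_not_annihilating:
  assumes f: "\<forall>\<^sub>F n in sequentially. f n \<noteq> 0"
    and deg: "\<forall>\<^sub>F n in sequentially. of_int (deg_q (f n)) = p n"
    and p: "\<And>n. p n = g2 n * of_nat (n choose 2) + g1 n * of_nat n + g0 n"
    and per: "\<And>n. g2 (n + N) = g2 n" "\<And>n. g1 (n + N) = g1 n" "\<And>n. g0 (n + N) = g0 n"
    and N: "0 < N"
    and sparse: "qshift.sparse N Q"
    and dom: "valued_difference_field.dominant degree_abs (2 powr of_rat (g2 r)) Q k"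
  shows "Q \<notin> ann_ideal f"
proof
  assume "Q \<in> ann_ideal f"
  then have ann: "\<forall>\<^sub>F n in sequentially. wloc_act Q f n = 0" by (simp add: ann_ideal_def)
  define s :: real where "s = of_rat (g2 r)"
  interpret valued_difference_field qshift degree_abs "2 powr s" by (rule valued_qshift) simp
  define \<alpha> where "\<alpha> j = real_of_int (fract_degree (coeff Q j)) + s * real j" for j
  define t where "t n j = eval_QMq n (coeff Q j) * f (n + j)" for n j
  define base where "base n = s * real (n choose 2) + of_rat (g1 r) * real n + of_rat (g0 r)" for n
  have weight_Q: "weight Q j = 2 powr \<alpha> j" if "coeff Q j \<noteq> 0" for j
    using that by (simp add: weight_def degree_abs_def \<alpha>_def powr_add powr_powr powr_realpow[symmetric])
  have dominant: "dominant Q k" using dom unfolding s_def .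
  then have Qk: "coeff Q k \<noteq> 0" by (simp add: dominant_def)
  have less: "\<alpha> j < \<alpha> k" if "coeff Q j \<noteq> 0" "j \<noteq> k" for j
  proof -
    have "weight Q j < weight Q k" using dominant that by (simp add: dominant_def)
    with that Qk show ?thesis by (simp add: weight_Q)
  qed
  define G where "G j e \<longleftrightarrow> (\<forall>\<^sub>F m in sequentially. t (r + N * m) j \<noteq> 0 \<and>
      real_of_int (fract_degree (t (r + N * m) j)) = base (r + N * m) + real (r + N * m) * \<alpha> j + e)" for j e
  have "\<exists>e. G j e" if Qj: "coeff Q j \<noteq> 0" for j
  proof -
    obtain l where l: "j = N * l" using Qj sparse by (auto simp: qshift.sparse_def)
    obtain e where "\<forall>\<^sub>F n in sequentially. eval_QMq n (coeff Q j) \<noteq> 0 \<and>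
      fract_degree (eval_QMq n (coeff Q j)) = int n * fract_degree (coeff Q j) + e"
      using deg_q_eval_QMq[OF Qj] by blast
    then have "\<forall>\<^sub>F m in sequentially. eval_QMq (r + N * m) (coeff Q j) \<noteq> 0 \<and>
      fract_degree (eval_QMq (r + N * m) (coeff Q j)) = int (r + N * m) * fract_degree (coeff Q j) + e"
      by (rule eventually_progression[OF _ N])
    moreover have "\<forall>\<^sub>F m in sequentially. f (r + j + N * m) \<noteq> 0"
      "\<forall>\<^sub>F m in sequentially. of_int (deg_q (f (r + j + N * m))) = p (r + j + N * m)"
      using f deg by (auto intro: eventually_progression[OF _ N])
    ultimately have "\<forall>\<^sub>F m in sequentially. t (r + N * m) j \<noteq> 0 \<and>
      real_of_int (fract_degree (t (r + N * m) j)) = base (r + N * m) + real (r + N * m) * \<alpha> j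
        + (real_of_int e + s * real (j choose 2) + of_rat (g1 r) * real j)"
    proof eventually_elim
      case (elim m)
      define n where "n = r + N * m"
      have nj: "n + j = r + N * (m + l)" "r + j + N * m = n + j"
        by (simp_all add: n_def l algebra_simps)
      have g: "g2 (n + j) = g2 r" "g1 (n + j) = g1 r" "g0 (n + j) = g0 r"
        unfolding nj(1) using per by (auto intro!: periodic_mult)
      have "real_of_int (fract_degree (f (n + j))) = of_rat (p (n + j))"
        using elim by (metis deg_q_eq_fract_degree nj(2) of_rat_of_int_eq)
      also have "\<dots> = s * real ((n + j) choose 2) + of_rat (g1 r) * real (n + j) + of_rat (g0 r)"
        by (simp add: p g s_def of_rat_add of_rat_mult)
      also have "real ((n + j) choose 2) = real (n choose 2) + real n * real j + real (j choose 2)"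
      proof -
        have ch: "real (i choose 2) = real i * (real i - 1) / 2" for i
          by (simp add: binomial_gbinomial gbinomial_prod_rev numeral_2_eq_2)
        show ?thesis unfolding ch by (simp add: field_simps)
      qed
      finally have "real_of_int (fract_degree (f (n + j))) = base n + s * real n * real j
          + s * real (j choose 2) + of_rat (g1 r) * real j"
        by (simp add: base_def algebra_simps)
      moreover have "f (n + j) \<noteq> 0" "eval_QMq n (coeff Q j) \<noteq> 0"
        "fract_degree (eval_QMq n (coeff Q j)) = int n * fract_degree (coeff Q j) + e"
        using elim nj(2) by (simp_all add: n_def)
      ultimately show ?case
        unfolding n_def[symmetric] by (simp add: t_def fract_degree_mult \<alpha>_def algebra_simps)
    qed
    then show ?thesis unfolding G_def by blast
  qed
  then obtain e where "\<And>j. coeff Q j \<noteq> 0 \<Longrightarrow> G j (e j)" by metis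
  note e = this[unfolded G_def]
  have "\<forall>\<^sub>F m in sequentially. degree_abs (t (r + N * m) j) < degree_abs (t (r + N * m) k)" if jk: "j \<noteq> k" for j
  proof (cases "coeff Q j = 0")
    case True
    then have t0: "t n j = 0" for n by (simp add: t_def eval_QMq_def eval_ZMq_def)
    from e[OF Qk] show ?thesis by eventually_elim (simp add: degree_abs.av_pos t0)
  next
    case False
    have "\<forall>\<^sub>F n in sequentially. (e j - e k) / (\<alpha> k - \<alpha> j) < real n"
      by (rule eventually_gt_at_top[THEN filterlim_real_sequentially[THEN eventually_compose_filterlim[rotated]]])
    then have "\<forall>\<^sub>F m in sequentially. (e j - e k) / (\<alpha> k - \<alpha> j) < real (r + N * m)"
      by (rule eventually_progression[OF _ N])
    with e[OF False] e[OF Qk] show ?thesis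
    proof eventually_elim
      case (elim m)
      then have "e j - e k < real (r + N * m) * (\<alpha> k - \<alpha> j)"
        using less[OF False jk] by (simp add: pos_divide_less_eq)
      with elim have "real_of_int (fract_degree (t (r + N * m) j)) < real_of_int (fract_degree (t (r + N * m) k))"
        by (simp add: algebra_simps)
      with elim show ?case by (simp add: degree_abs_def)
    qed
  qed
  then have "\<forall>\<^sub>F m in sequentially. \<forall>j\<in>{..degree Q} - {k}. degree_abs (t (r + N * m) j) < degree_abs (t (r + N * m) k)"
    by (intro eventually_ball_finite) auto
  with e[OF Qk] eventually_progression[OF ann N, of r]
  have "\<forall>\<^sub>F m in sequentially. False"
  proof eventually_elim
    case (elim m)
    have "degree_abs (sum (t (r + N * m)) {..degree Q}) = degree_abs (t (r + N * m) k)"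
      using elim Qk by (intro degree_abs.av_sum_dominant) (auto simp: le_degree)
    moreover have "sum (t (r + N * m)) {..degree Q} = 0"
      using elim by (simp add: wloc_act_def t_def)
    ultimately show False using elim degree_abs.av_pos[of "t (r + N * m) k"] by simp
  qed
  then show False by simp
qed

section \<open>Edges of the Newton polygon\<close>

lemma finite_newton_points:
  fixes P :: weyl
  shows "finite {(real i, real j) | i j k. coeff (coeff (coeff P i) j) k \<noteq> 0}"
proof (rule finite_subset)
  show "{(real i, real j) | i j k. coeff (coeff (coeff P i) j) k \<noteq> 0}
      \<subseteq> (\<lambda>(i, j). (real i, real j)) ` (SIGMA i:{..degree P}. {..degree (coeff P i)})"
  proof (clarify)
    fix i j k assume "coeff (coeff (coeff P i) j) k \<noteq> 0"
    then have "coeff (coeff P i) j \<noteq> 0" "coeff P i \<noteq> 0" by auto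
    then have "(i, j) \<in> (SIGMA i:{..degree P}. {..degree (coeff P i)})" by (simp add: le_degree)
    then show "(real i, real j) \<in> (\<lambda>(i, j). (real i, real j)) ` (SIGMA i:{..degree P}. {..degree (coeff P i)})"
      by (rule rev_image_eqI) simp
  qed
qed auto

text \<open>The part of the polygon on which \<open>(i, j) \<mapsto> j + s i\<close> is maximal is a face contained in a line of slope
  \<open>-s\<close>. If two columns of the polygon attain the maximum, then this face is a segment, hence an edge.\<close>
lemma slope_or_unique_maximum:
  fixes P :: weyl and s :: real
  assumes "P \<noteq> 0" and no_slope: "ereal (- s) \<notin> polygon_slopes (newton_polygon0 P)"
  obtains c where "coeff P c \<noteq> 0" "\<And>i. i \<noteq> c \<Longrightarrow> coeff P i \<noteq> 0 \<Longrightarrow>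
    real (degree (coeff P i)) + s * real i < real (degree (coeff P c)) + s * real c"
proof -
  define S where "S = {(real i, real j) | i j k. coeff (coeff (coeff P i) j) k \<noteq> 0}"
  define h where "h i = real (degree (coeff P i)) + s * real i" for i
  define I where "I = {i. coeff P i \<noteq> 0}"
  have "I \<subseteq> {..degree P}" by (auto simp: I_def le_degree)
  then have "finite I" using finite_subset by blast
  moreover have "I \<noteq> {}" using assms(1) by (auto simp: I_def poly_eq_iff)
  ultimately obtain c where c: "c \<in> I" "\<And>i. i \<in> I \<Longrightarrow> h i \<le> h c"
    using Max_in[of "h ` I"] Max_ge[of "h ` I"] by (metis (no_types, lifting) finite_imageI image_iff image_is_empty)
  define N where "N = newton_polygon0 P"
  have N: "N = convex hull S" by (simp add: N_def newton_polygon0_def S_def)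
  have "h c' < h c" if c': "c' \<noteq> c" "c' \<in> I" for c'
  proof (rule ccontr)
    assume "\<not> h c' < h c"
    with c c' have hc': "h c' = h c" by (metis order.antisym not_less)
    define F where "F = N \<inter> {x. (s, 1) \<bullet> x = h c}"
    have "S \<subseteq> {x. (s, 1) \<bullet> x \<le> h c}"
    proof (clarsimp simp: S_def)
      fix i j k assume nz: "coeff (coeff (coeff P i) j) k \<noteq> 0"
      then have "j \<le> degree (coeff P i)" by (intro le_degree) auto
      moreover have "i \<in> I" using nz by (auto simp: I_def)
      then have "h i \<le> h c" by (rule c(2))
      ultimately show "s * real i + real j \<le> h c" by (simp add: h_def)
    qed
    then have "N \<subseteq> {x. (s, 1) \<bullet> x \<le> h c}"
      unfolding N by (rule hull_minimal) (rule convex_halfspace_le)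
    then have N_le: "(s, 1) \<bullet> x \<le> h c" if "x \<in> N" for x using that by blast
    have face: "F face_of N"
      unfolding F_def using N_le by (intro face_of_Int_supporting_hyperplane_le) (simp_all add: N)
    have point: "(real i, real (degree (coeff P i))) \<in> F" if "i \<in> I" "h i = h c" for i
    proof -
      have "(real i, real (degree (coeff P i))) \<in> S"
        using that(1) unfolding S_def I_def
        by (auto intro!: exI[of _ "degree (lead_coeff (coeff P i))"])
      then have "(real i, real (degree (coeff P i))) \<in> N" unfolding N by (rule hull_inc)
      with that(2) show ?thesis by (simp add: F_def h_def)
    qed
    have "compact N"
      unfolding N S_def by (intro finite_imp_compact_convex_hull finite_newton_points)
    then have "compact F" unfolding F_def by (intro compact_Int_closed closed_hyperplane)
    moreover have "convex F" using face by (rule face_of_imp_convex)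
    moreover have line: "snd x - snd y = - s * (fst x - fst y)" if "x \<in> F" "y \<in> F" for x y
      using that by (simp add: F_def inner_prod_def algebra_simps)
    then have "collinear F"
      unfolding collinear_def
      by (intro exI[of _ "(1, - s)"] ballI) (auto simp: prod_eq_iff)
    moreover have "F \<noteq> {}" using point[OF c(1)] by auto
    ultimately obtain u v where uv: "F = closed_segment u v"
      using compact_convex_collinear_segment by metis
    have "u \<noteq> v"
    proof
      assume "u = v"
      then have "F = {u}" by (simp add: uv)
      then show False using point[OF c(1)] point[OF c'(2) hc'] c'(1) by auto
    qed
    then have "aff_dim F = 1" by (simp add: uv segment_convex_hull aff_dim_convex_hull aff_dim_2)
    with face have "closed_segment u v edge_of N" by (simp add: edge_of_def uv)
    moreover have "slope u v = ereal (- s)"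
    proof -
      have l: "snd u - snd v = - s * (fst u - fst v)" by (rule line) (simp_all add: uv)
      then have "fst u \<noteq> fst v" using \<open>u \<noteq> v\<close> by (auto simp: prod_eq_iff)
      with l show ?thesis by (simp add: slope_def)
    qed
    ultimately have "ereal (- s) \<in> polygon_slopes N"
      unfolding polygon_slopes_def using \<open>u \<noteq> v\<close>
      by (intro CollectI exI[of _ u] exI[of _ v]) simp
    with no_slope show False by (simp add: N_def)
  qed
  with c that[of c] show ?thesis by (auto simp: I_def h_def)
qed

section \<open>Slopes of the degree and slopes of the polygon\<close>

theorem proposition1p6:
  fixes f :: "nat \<Rightarrow> Qq" and P :: weyl
  assumes "q_holonomic f"
    and "\<forall>\<^sub>F n in sequentially. f n \<noteq> 0"
    and "homogeneous_annihilator f P"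
  shows "(\<lambda>s. ereal (of_rat s)) ` seq_slopes f \<subseteq> uminus ` polygon_slopes (newton_polygon0 P)"
proof (clarify)
  fix s0 :: rat
  assume "s0 \<in> seq_slopes f"
  then obtain p g2 g1 g0 r where deg: "\<forall>\<^sub>F n in sequentially. of_int (deg_q (f n)) = p n"
    and p: "qqp_coeffs p g2 g1 g0" and s0: "s0 = g2 r"
    by (auto simp: seq_slopes_def qqp_slopes_def)
  from p obtain N2 N1 N0 where N: "0 < N2" "0 < N1" "0 < N0"
    "\<forall>n. g2 (n + N2) = g2 n" "\<forall>n. g1 (n + N1) = g1 n" "\<forall>n. g0 (n + N0) = g0 n"
    by (auto simp: qqp_coeffs_def periodic_def)
  define N where "N = N2 * N1 * N0"
  have N_pos: "0 < N" using N by (simp add: N_def)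
  have per: "g2 (n + N) = g2 n" "g1 (n + N) = g1 n" "g0 (n + N) = g0 n" for n
    using periodic_mult[OF N(4), of n "N1 * N0"] periodic_mult[OF N(5), of n "N2 * N0"]
      periodic_mult[OF N(6), of n "N2 * N1"] by (simp_all add: N_def ac_simps)
  define s :: real where "s = of_rat s0"
  from assms(3) obtain P' c where P': "monic_generator (ann_ideal f) P'" "c \<noteq> 0"
    "map_poly to_fract P = smult c P'" by (auto simp: homogeneous_annihilator_def)
  have coeff_P: "to_fract (coeff P i) = c * coeff P' i" for i
    using arg_cong[OF P'(3), of "\<lambda>p. coeff p i"] by (simp add: coeff_map_poly)
  have "ereal (- s) \<in> polygon_slopes (newton_polygon0 P)"
  proof (rule ccontr)
    assume no: "ereal (- s) \<notin> polygon_slopes (newton_polygon0 P)"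
    have "P' \<noteq> 0" using P'(1) by (auto simp: monic_generator_def)
    with P' have "P \<noteq> 0" by auto
    then obtain k where k: "coeff P k \<noteq> 0" "\<And>i. i \<noteq> k \<Longrightarrow> coeff P i \<noteq> 0 \<Longrightarrow>
        real (degree (coeff P i)) + s * real i < real (degree (coeff P k)) + s * real k"
      using slope_or_unique_maximum[OF _ no] by metis
    interpret valued_difference_field qshift degree_abs "2 powr s" by (rule valued_qshift) simp
    have nz: "coeff P' i \<noteq> 0 \<longleftrightarrow> coeff P i \<noteq> 0" for i
      using coeff_P[of i] P'(2) by (metis mult_eq_0_iff to_fract_eq_0_iff)
    \<comment> \<open>The factor \<open>c\<close> between \<open>P\<close> and \<open>P'\<close> rescales all weights alike.\<close>
    have weight_P': "weight P' i = 2 powr (real (degree (coeff P i)) + s * real i - real_of_int (fract_degree c))"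
      if "coeff P i \<noteq> 0" for i
    proof -
      have "fract_degree (to_fract (coeff P i)) = fract_degree c + fract_degree (coeff P' i)"
        unfolding coeff_P using that nz P'(2) by (simp add: fract_degree_mult)
      moreover have "fract_degree (to_fract (coeff P i)) = int (degree (coeff P i))"
        using that by (simp add: to_fract_def fract_degree_Fract)
      ultimately have "real_of_int (fract_degree (coeff P' i)) = real (degree (coeff P i)) - real_of_int (fract_degree c)"
        by linarith
      then show ?thesis
        using that nz[of i] by (simp add: weight_def degree_abs_def powr_powr powr_realpow[symmetric]
            powr_add[symmetric] add.commute add_diff_eq)
    qed
    have "dominant P' k"
      unfolding dominant_def
    proof (intro conjI allI impI)
      fix i assume "i \<noteq> k"
      with k nz show "weight P' i < weight P' k"
        by (cases "coeff P i = 0") (auto simp: weight_P')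
    qed (use k nz in auto)
    then obtain A l where A: "qshift.sparse N (qshift.skew_mult A P')" "dominant (qshift.skew_mult A P') l"
      using dominant_sparse_multiple[OF _ N_pos] by metis
    have "qshift.skew_mult A P' \<in> ann_ideal f"
      using P'(1) unfolding monic_generator_def wloc_mult_eq_skew_mult by blast
    moreover have "qshift.skew_mult A P' \<notin> ann_ideal f"
    proof (rule sparse_dominant_not_annihilating[where p = p and ?g2.0 = g2 and ?g1.0 = g1 and ?g0.0 = g0
          and N = N and r = r and k = l])
      show "p n = g2 n * of_nat (n choose 2) + g1 n * of_nat n + g0 n" for n
        using p by (simp add: qqp_coeffs_def)
      show "valued_difference_field.dominant degree_abs (2 powr of_rat (g2 r)) (qshift.skew_mult A P') l"
        using A(2) unfolding s_def s0 .
    qed (fact assms(2) deg per N_pos A(1))+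
    ultimately show False by blast
  qed
  then show "ereal (of_rat s0) \<in> uminus ` polygon_slopes (newton_polygon0 P)"
    by (rule rev_image_eqI) (simp add: s_def)
qed

end
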